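(* Fix integers $K,M,N\ge1$ and constants $P_c>0$, $P_{\max}>0$. Let $(\tilde{\mathbf{H}}(n))_{n\ge1}$ be a sequence of block-diagonal matrices $\tilde{\mathbf{H}}(n)=\operatorname{diag}(\tilde{\mathbf{H}}_1(n),\dots,\tilde{\mathbf{H}}_K(n))$, $\tilde{\mathbf{H}}_k(n)\in\mathbb{C}^{N\times M}$, with gradients satisfying $\|\mathbf{V}(n)\|\le V_0$ for all $n$ (notation as in the context). Let $\mathbf{X}(n)$ be generated by the noisy recursion $\mathbf{X}(n+1)=\boldsymbol{\Pi}(\mathbf{X}(n)+\gamma_n\hat{\mathbf{V}}(n))$ from an initial point $\mathbf{X}(1)\in\mathcal{X}$, where $\hat{\mathbf{V}}(n)$ are random Hermitian estimates of $\mathbf{V}(n)$ satisfying: (H1) unbiasedness: $\mathbb{E}[\hat{\mathbf{V}}(n)\mid\mathcal{F}_n]=\mathbf{V}(n)$, where $\mathcal{F}_n$ is the history of the process up to the choice of $\mathbf{X}(n)$; (H2) tame error tails: there exist $B>0$ and $\beta>2$ such that $\mathbb{P}(\|\hat{\mathbf{V}}(n)-\mathbf{V}(n)\|\ge z)\le B/z^\beta$ for all $z>0$ and all $n$. Suppose the step-sizes are $\gamma_n=\gamma/n^\alpha$ with $\gamma>0$ and $\alpha\in(2/\beta,1)$, and let $\mathbf{Q}(n)=\mathbf{Q}(\mathbf{X}(n))$. Then $\mathbf{Q}(n)$ leads to no regret almost surely, i.e. $\limsup_{T\to\infty}T^{-1}\mathrm{Reg}(T)\le0$ a.s., and $$\mathbb{E}[\mathrm{Reg}(T)]\le\frac{1}{\gamma_T}+\frac{\hat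 V_0^2}{2}\sum_{n=1}^T\gamma_n\quad\text{for all }T\ge1,$$ where $\hat V_0^2=\sup_n\mathbb{E}[\|\hat{\mathbf{V}}(n)\|^2]$.
   Context: All matrices are complex; $\mathbf{A}^\dagger$ is the conjugate transpose and $\|\mathbf{A}\|=\operatorname{tr}(\mathbf{A}^\dagger\mathbf{A})^{1/2}$ the Frobenius norm. The effective channel matrices $\tilde{\mathbf{H}}(n)$ are assumed uniformly bounded in $n$. $\mathcal{Q}=\{\mathbf{Q}=\operatorname{diag}(\mathbf{Q}_1,\dots,\mathbf{Q}_K):\mathbf{Q}_k\in\mathbb{C}^{M\times M}\text{ Hermitian},\ \mathbf{Q}_k\succeq0,\ \sum_k\operatorname{tr}\mathbf{Q}_k\le P_{\max}\}$. $\mathrm{EE}(\mathbf{Q};n)=\dfrac{\log\det(\mathbf{I}+\tilde{\mathbf{H}}(n)\mathbf{Q}\tilde{\mathbf{H}}(n)^\dagger)}{P_c+\operatorname{tr}\mathbf{Q}}$, $R_n(\mathbf{Q})=\log\det(\mathbf{I}+\tilde{\mathbf{H}}(n)\mathbf{Q}\tilde{\mathbf{H}}(n)^\dagger)$. $\mathcal{X}=\{\mathbf{X}=\operatorname{diag}(\mathbf{X}_1,\dots,\mathbf{X}_K):\mathbf{X}_k\text{ Hermitian } M\times M,\ \mathbf{X}_k\succeq0,\ \sum_k\operatorname{tr}\mathbf{X}_k\le1\}$, $\mathbf{Q}(\mathbf{X})=\dfrac{P_cP_{\max}}{P_c+P_{\max}(1-\operatorname{tr}\mathbf{X})}\mathbf{X}$,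 $u(\mathbf{X};n)=\mathrm{EE}(\mathbf{Q}(\mathbf{X});n)$. True gradient: $\mathbf{V}(n)=\nabla_{\mathbf{X}}u(\mathbf{X}(n);n)=\dfrac{P_{\max}}{P_c+P_{\max}}\Big[\mathbf{A}_n+\dfrac{\operatorname{tr}(\mathbf{A}_n\mathbf{Q}(n))-R_n(\mathbf{Q}(n))}{P_c}\mathbf{I}\Big]$ with $\mathbf{A}_n=\tilde{\mathbf{H}}(n)^\dagger[\mathbf{I}+\tilde{\mathbf{H}}(n)\mathbf{Q}(n)\tilde{\mathbf{H}}(n)^\dagger]^{-1}\tilde{\mathbf{H}}(n)$. $\boldsymbol{\Pi}(\mathbf{Y})=\arg\min_{\mathbf{X}\in\mathcal{X}}\|\mathbf{X}-\mathbf{Y}\|^2$. $\mathrm{Reg}(T)=\max_{\mathbf{Q}\in\mathcal{Q}}\sum_{n=1}^T[\mathrm{EE}(\mathbf{Q};n)-\mathrm{EE}(\mathbf{Q}(n);n)]$. *)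

theory Defs
  imports "HOL-Analysis.Analysis" "HOL-Probability.Probability"
begin

text \<open>Complex matrices are rendered as type-indexed matrices.  Index type 'k enumerates
  the K users, 'm the M transmit antennas, 'n the N receive antennas.  A block-diagonal
  KM x KM matrix is a matrix indexed by 'k \<times> 'm whose off-diagonal blocks vanish.
  The norm on complex^'c^'r is the Frobenius norm.\<close>

definition adjc :: "complex^'c^'r \<Rightarrow> complex^'r^'c" where
  "adjc A = (\<chi> i j. cnj (A $ j $ i))"

definition hermitian :: "complex^'r^'r \<Rightarrow> bool" where
  "hermitian A \<longleftrightarrow> adjc A = A"

definition psd :: "complex^'r^'r \<Rightarrow> bool" where
  "psd A \<longleftrightarrow> hermitian A \<and>
     (\<forall>x::complex^'r. 0 \<le> Re (\<Sum>i\<in>UNIV. \<Sum>j\<in>UNIV. cnj (x $ i) * A $ i $ j * x $ j))"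

definition block_diag :: "complex^('k::finite \<times> 'c::finite)^('k \<times> 'r::finite) \<Rightarrow> bool" where
  "block_diag A \<longleftrightarrow> (\<forall>k k' i j. k \<noteq> k' \<longrightarrow> A $ (k, i) $ (k', j) = 0)"

text \<open>The feasible set \<Q> (sum of block traces = trace of Q).\<close>
definition QSet :: "real \<Rightarrow> (complex^('k::finite \<times> 'm::finite)^('k \<times> 'm)) set" where
  "QSet Pmax = {Q. block_diag Q \<and> psd Q \<and> Re (trace Q) \<le> Pmax}"

definition XSet :: "(complex^('k::finite \<times> 'm::finite)^('k \<times> 'm)) set" where
  "XSet = {X. block_diag X \<and> psd X \<and> Re (trace X) \<le> 1}"

text \<open>R_n(Q) = log det (I + H Q H^dagger) (natural logarithm; the determinant is real).\<close>
definition rate :: "complex^('k::finite \<times> 'm::finite)^('k \<times> 'n::finite) \<Rightarrow> complex^('k \<times> 'm)^('k \<times> 'm) \<Rightarrow> real" where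
  "rate H Q = ln (Re (det (mat 1 + H ** Q ** adjc H)))"

definition EE :: "real \<Rightarrow> complex^('k::finite \<times> 'm::finite)^('k \<times> 'n::finite) \<Rightarrow> complex^('k \<times> 'm)^('k \<times> 'm) \<Rightarrow> real" where
  "EE Pc H Q = rate H Q / (Pc + Re (trace Q))"

definition Qmap :: "real \<Rightarrow> real \<Rightarrow> complex^('k::finite \<times> 'm::finite)^('k \<times> 'm) \<Rightarrow> complex^('k \<times> 'm)^('k \<times> 'm)" where
  "Qmap Pc Pmax X = (Pc * Pmax / (Pc + Pmax * (1 - Re (trace X)))) *\<^sub>R X"

definition gradV :: "real \<Rightarrow> real \<Rightarrow> complex^('k::finite \<times> 'm::finite)^('k \<times> 'n::finite) \<Rightarrow> complex^('k \<times> 'm)^('k \<times> 'm)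
    \<Rightarrow> complex^('k \<times> 'm)^('k \<times> 'm)" where
  "gradV Pc Pmax H X =
     (let Q = Qmap Pc Pmax X;
          A = adjc H ** matrix_inv (mat 1 + H ** Q ** adjc H) ** H
      in (Pmax / (Pc + Pmax)) *\<^sub>R (A + ((Re (trace (A ** Q)) - rate H Q) / Pc) *\<^sub>R mat 1))"

definition proj :: "complex^('k::finite \<times> 'm::finite)^('k \<times> 'm) \<Rightarrow> complex^('k \<times> 'm)^('k \<times> 'm)" where
  "proj Y = (SOME X. X \<in> XSet \<and> (\<forall>X'\<in>XSet. norm (X - Y) \<le> norm (X' - Y)))"

definition regret :: "real \<Rightarrow> real \<Rightarrow> (nat \<Rightarrow> complex^('k::finite \<times> 'm::finite)^('k \<times> 'n::finite))
    \<Rightarrow> (nat \<Rightarrow> complex^('k \<times> 'm)^('k \<times> 'm)) \<Rightarrow> nat \<Rightarrow> real" where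
  "regret Pc Pmax H Qs T =
     (SUP Q\<in>QSet Pmax. \<Sum>n = 1..T. EE Pc (H n) Q - EE Pc (H n) (Qs n))"

end

theory Submission
  imports Defs "HOL-Library.Discrete_Functions" "HOL-Real_Asymp.Real_Asymp"
begin

text \<open>
  In the variable \<open>X\<close> the energy efficiency is, up to a factor, the perspective of the concave
  function \<open>log det (I + H Q H\<^sup>\<dagger>)\<close>, hence concave with supergradient \<open>V(n)\<close>.  So the regret is at most
  the sum of \<open>\<langle>V(n), X - X(n)\<rangle>\<close>, which splits into the linear regret of projected gradient
  steps along the estimates and a martingale noise term.  The former is handled by the usual
  telescoping estimate with \<open>\<parallel>X - Y\<parallel>\<^sup>2 \<le> 2\<close> on the feasible set.  The noise has mean zero; its
  tail bound gives uniformly bounded second moments, so its averages vanish almost surely by the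
  strong law for orthogonal variables.  Since the noise is paired with \<open>X\<close> only through its sum, this
  holds uniformly in \<open>X\<close>.
\<close>

section \<open>Complex matrices\<close>

lemma adjc_nth [simp]: "adjc A $ i $ j = cnj (A $ j $ i)"
  by (simp add: adjc_def)

lemma adjc_adjc [simp]: "adjc (adjc A) = A"
  by (simp add: vec_eq_iff)

lemma adjc_add: "adjc (A + B) = adjc A + adjc B"
  by (simp add: vec_eq_iff)

lemma adjc_scaleR: "adjc (c *\<^sub>R A) = c *\<^sub>R adjc A"
  by (simp add: vec_eq_iff)

lemma adjc_mat_1 [simp]: "adjc (mat 1) = mat 1"
  by (simp add: vec_eq_iff mat_def)

lemma adjc_mult: "adjc (A ** B) = adjc B ** adjc A"
  by (simp add: vec_eq_iff matrix_matrix_mult_def mult.commute)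

lemma det_adjc: "det (adjc A) = cnj (det A)"
proof -
  have "det (adjc A) = det (\<chi> i j. cnj (transpose A $ i $ j))"
    by (simp add: adjc_def transpose_def)
  also have "\<dots> = cnj (det (transpose A))"
    by (simp add: det_def)
  finally show ?thesis by simp
qed

lemma trace_scaleR: "trace (c *\<^sub>R A) = c *\<^sub>R trace (A :: 'a::{semiring_1, real_vector}^'n^'n)"
  by (simp add: trace_def scaleR_sum_right)

lemma matrix_mult_diff_right: "A ** (B - C) = A ** B - A ** (C :: 'a::ring_1^'n^'m)"
  by (simp add: vec_eq_iff matrix_matrix_mult_def algebra_simps sum_subtractf)

lemma matrix_mult_diff_left: "(A - B) ** C = A ** C - B ** (C :: 'a::ring_1^'n^'m)"
  by (simp add: vec_eq_iff matrix_matrix_mult_def algebra_simps sum_subtractf)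

lemma matrix_inv_right:
  fixes A :: "'a::field^'n^'n"
  assumes "det A \<noteq> 0"
  shows "A ** matrix_inv A = mat 1"
proof -
  have "\<exists>A'. A ** A' = mat 1 \<and> A' ** A = mat 1"
    using assms by (simp add: invertible_det_nz[symmetric] invertible_def)
  from someI_ex[OF this] show ?thesis
    by (simp add: matrix_inv_def)
qed

lemma matrix_inv_unique:
  fixes A :: "'a::field^'n^'n"
  assumes "B ** A = mat 1"
  shows "matrix_inv A = B"
proof -
  have "det A \<noteq> 0"
    using assms by (metis det_I det_mul mult_zero_right zero_neq_one)
  then have "B ** (A ** matrix_inv A) = B"
    by (simp add: matrix_inv_right)
  then show ?thesis
    by (simp add: matrix_mul_assoc assms)
qed

definition diag_mat :: "('n \<Rightarrow> 'a::zero) \<Rightarrow> 'a^'n^'n" where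
  "diag_mat d = (\<chi> i j. if i = j then d i else 0)"

lemma diag_mat_nth [simp]: "diag_mat d $ i $ j = (if i = j then d i else 0)"
  by (simp add: diag_mat_def)

lemma det_diag_mat: "det (diag_mat d) = (\<Prod>i\<in>UNIV. d i)"
  by (simp add: det_diagonal)

lemma diag_mat_mult_diag_mat:
  "diag_mat d ** diag_mat e = (diag_mat (\<lambda>i. d i * e i) :: 'a::semiring_1^'n^'n)"
  by (auto simp: vec_eq_iff matrix_matrix_mult_def if_distrib[of "\<lambda>x. _ * x"] cong: if_cong)

lemma matrix_inv_of_congruent_diag:
  fixes L P :: "complex^'n^'n"
  assumes diagonal: "L ** P ** adjc L = diag_mat d" and d_nonzero: "\<And>i. d i \<noteq> 0"
  shows "matrix_inv P = adjc L ** diag_mat (\<lambda>i. 1 / d i) ** L"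
proof (rule matrix_inv_unique)
  have "diag_mat (\<lambda>i. 1 / d i) ** (L ** P ** adjc L) = mat 1"
    using d_nonzero by (simp add: diagonal diag_mat_mult_diag_mat) (simp add: diag_mat_def mat_def)
  then have "(diag_mat (\<lambda>i. 1 / d i) ** L ** P) ** adjc L = mat 1"
    by (simp add: matrix_mul_assoc)
  then have "adjc L ** (diag_mat (\<lambda>i. 1 / d i) ** L ** P) = mat 1"
    using matrix_left_right_inverse by blast
  then show "adjc L ** diag_mat (\<lambda>i. 1 / d i) ** L ** P = mat 1"
    by (simp add: matrix_mul_assoc)
qed

lemma inner_eq_Re_trace: "inner A B = Re (trace (A ** adjc B))"
  by (simp add: inner_vec_def inner_complex_def trace_def matrix_matrix_mult_def)

lemma inner_mat_1: "inner (mat 1) B = Re (trace B)"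
  by (simp add: inner_eq_Re_trace) (simp add: trace_def)

lemma inner_diag_mat: "inner (diag_mat (\<lambda>i. of_real (d i))) A = (\<Sum>i\<in>UNIV. d i * Re (A $ i $ i))"
  by (simp add: inner_vec_def inner_complex_def if_distrib[of Re] if_distrib[of Im]
      if_distrib[of "\<lambda>x. x * _"] cong: if_cong)

lemma inner_congruence: "inner A (K ** B ** adjc K) = inner (adjc K ** A ** K) B"
proof -
  have "inner A (K ** B ** adjc K) = Re (trace ((A ** K ** adjc B) ** adjc K))"
    by (simp add: inner_eq_Re_trace adjc_mult matrix_mul_assoc)
  also have "\<dots> = Re (trace (adjc K ** (A ** K ** adjc B)))"
    by (rule arg_cong[OF trace_mul_sym])
  finally show ?thesis
    by (simp add: inner_eq_Re_trace matrix_mul_assoc)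
qed

lemma Basis_complex_matrix_cases:
  fixes b :: "complex^'n^'m"
  assumes "b \<in> Basis"
  obtains (Re) i j where "\<And>A. inner A b = Re (A $ i $ j)"
    | (Im) i j where "\<And>A. inner A b = Im (A $ i $ j)"
  using assms by (auto simp: Basis_vec_def Basis_complex_def inner_axis)

definition cinner :: "complex^'n \<Rightarrow> complex^'n \<Rightarrow> complex" where
  "cinner x y = (\<Sum>i\<in>UNIV. cnj (x $ i) * y $ i)"

lemma cinner_add_left: "cinner (x + y) z = cinner x z + cinner y z"
  by (simp add: cinner_def distrib_right sum.distrib)

lemma cinner_add_right: "cinner x (y + z) = cinner x y + cinner x z"
  by (simp add: cinner_def distrib_left sum.distrib)

lemma cinner_scale_left: "cinner (c *s x) y = cnj c * cinner x y"
  by (simp add: cinner_def sum_distrib_left mult_ac)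

lemma cinner_scale_right: "cinner x (c *s y) = c * cinner x y"
  by (simp add: cinner_def sum_distrib_left mult_ac)

lemma cinner_commute: "cinner y x = cnj (cinner x y)"
  by (simp add: cinner_def mult.commute)

lemma cinner_axis: "cinner (axis i 1) y = y $ i"
  by (simp add: cinner_def axis_def if_distrib[of cnj] if_distrib[of "\<lambda>x. x * _"] cong: if_cong)

lemma Re_cinner_self: "Re (cinner x x) = (norm x)\<^sup>2"
  by (simp add: cinner_def norm_vec_def L2_set_def sum_nonneg cmod_power2 flip: power2_eq_square)

lemma cinner_adjc: "cinner x (A *v y) = cinner (adjc A *v x) y"
proof -
  have "cinner x (A *v y) = (\<Sum>i\<in>UNIV. \<Sum>j\<in>UNIV. cnj (x $ i) * (A $ i $ j * y $ j))"
    by (simp add: cinner_def matrix_vector_mult_def sum_distrib_left)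
  also have "\<dots> = (\<Sum>j\<in>UNIV. \<Sum>i\<in>UNIV. cnj (x $ i) * (A $ i $ j * y $ j))"
    by (rule sum.swap)
  finally show ?thesis
    by (simp add: cinner_def matrix_vector_mult_def sum_distrib_right sum_distrib_left mult_ac)
qed

section \<open>Positive semidefinite matrices\<close>

lemma hermitian_nth: "hermitian A \<Longrightarrow> A $ j $ i = cnj (A $ i $ j)"
  unfolding hermitian_def by (metis adjc_nth)

lemma hermitian_diag: "hermitian A \<Longrightarrow> A $ i $ i = of_real (Re (A $ i $ i))"
  by (metis complex_is_Real_iff hermitian_nth Reals_cnj_iff of_real_Re)

lemma psd_hermitian: "psd A \<Longrightarrow> hermitian A"
  by (simp add: psd_def)

lemma psd_iff_cinner: "psd A \<longleftrightarrow> hermitian A \<and> (\<forall>x. 0 \<le> Re (cinner x (A *v x)))"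
  by (simp add: psd_def cinner_def matrix_vector_mult_def sum_distrib_left mult.assoc)

lemma psd_cinner_nonneg: "psd A \<Longrightarrow> 0 \<le> Re (cinner x (A *v x))"
  by (simp add: psd_iff_cinner)

lemma psd_congruence:
  assumes "psd A"
  shows "psd (L ** A ** adjc L)"
proof -
  have "cinner x ((L ** A ** adjc L) *v x) = cinner (adjc L *v x) (A *v (adjc L *v x))" for x
    by (simp add: cinner_adjc[of x L] flip: matrix_vector_mul_assoc)
  moreover have "adjc (L ** A ** adjc L) = L ** adjc A ** adjc L"
    by (simp add: adjc_mult matrix_mul_assoc)
  ultimately show ?thesis
    using assms by (simp add: psd_iff_cinner hermitian_def)
qed

lemma psd_add:
  assumes "psd A" "psd B"
  shows "psd (A + B)"
  using assms
  by (simp add: psd_iff_cinner hermitian_def adjc_add matrix_vector_mult_add_rdistrib cinner_add_right)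

lemma psd_scaleR:
  assumes "psd A" "0 \<le> c"
  shows "psd (c *\<^sub>R A)"
proof -
  have "cinner x ((c *\<^sub>R A) *v x) = c *\<^sub>R cinner x (A *v x)" for x
    by (simp add: cinner_def matrix_vector_mult_def flip: scaleR_sum_right)
  then show ?thesis
    using assms by (simp add: psd_iff_cinner hermitian_def adjc_scaleR)
qed

lemma psd_mat_1: "psd (mat 1)"
  by (simp add: psd_iff_cinner hermitian_def Re_cinner_self)

lemma cinner_matrix_axis: "cinner (axis i 1) (A *v axis j 1) = A $ i $ j"
  by (simp add: cinner_axis)
    (simp add: matrix_vector_mult_def axis_def if_distrib[of "\<lambda>x. _ * x"] cong: if_cong)

lemma psd_diag_nonneg: "psd A \<Longrightarrow> 0 \<le> Re (A $ i $ i)"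
  using psd_cinner_nonneg[of A "axis i 1"] by (simp add: cinner_matrix_axis)

lemma psd_trace_nonneg: "psd A \<Longrightarrow> 0 \<le> Re (trace A)"
  by (simp add: trace_def sum_nonneg psd_diag_nonneg)

lemma le_mult_of_quadratic_form_nonneg:
  fixes a p q :: real
  assumes nonneg: "0 \<le> p" "0 \<le> q" "0 \<le> a"
    and form_nonneg: "\<And>s t. 0 \<le> p * t\<^sup>2 - 2 * t * s * a + s\<^sup>2 * q * a"
  shows "a \<le> p * q"
proof (cases "q = 0")
  case True
  have "(p + 2) * a\<^sup>2 \<le> 0"
    using form_nonneg[of a "p + 1"] True by (simp add: algebra_simps power2_eq_square)
  then have "a = 0"
    using nonneg(1) by (simp add: mult_le_0_iff)
  then show ?thesis
    using nonneg by simp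
next
  case False
  have "0 \<le> q * (p * q - a)"
    using form_nonneg[of q 1] by (simp add: algebra_simps power2_eq_square)
  then show ?thesis
    using False nonneg(2) by (simp add: zero_le_mult_iff)
qed

text \<open>The quadratic form is evaluated at \<open>t x - s c\<^sup>* y\<close> with \<open>c = \<langle>x, A y\<rangle>\<close>.\<close>

lemma psd_Cauchy_Schwarz:
  assumes "psd A"
  shows "(cmod (cinner x (A *v y)))\<^sup>2 \<le> Re (cinner x (A *v x)) * Re (cinner y (A *v y))"
proof (rule le_mult_of_quadratic_form_nonneg)
  define c where "c = cinner x (A *v y)"
  have swap: "cinner y (A *v x) = cnj c"
    using psd_hermitian[OF assms] by (metis c_def cinner_adjc cinner_commute hermitian_def)
  have expand: "cinner (a *s x + b *s y) (A *v (a *s x + b *s y)) =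
      cnj a * a * cinner x (A *v x) + cnj a * b * c + cnj b * a * cnj c + cnj b * b * cinner y (A *v y)"
    for a b
    by (simp add: matrix_vector_right_distrib vector_scalar_commute cinner_add_left cinner_add_right
        cinner_scale_left cinner_scale_right swap algebra_simps flip: c_def)
  fix s t :: real
  let ?w = "of_real t *s x + (- of_real s * cnj c) *s y"
  have "0 \<le> Re (cinner ?w (A *v ?w))"
    by (rule psd_cinner_nonneg[OF assms])
  also have "cinner ?w (A *v ?w) = of_real (t\<^sup>2) * cinner x (A *v x) - of_real (2 * t * s) * (c * cnj c)
      + of_real (s\<^sup>2) * (c * cnj c) * cinner y (A *v y)"
    unfolding expand by (simp add: algebra_simps power2_eq_square)
  also have "Re \<dots> = Re (cinner x (A *v x)) * t\<^sup>2 - 2 * t * s * (cmod c)\<^sup>2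
      + s\<^sup>2 * Re (cinner y (A *v y)) * (cmod c)\<^sup>2"
    by (simp flip: complex_norm_square of_real_power)
  finally show "0 \<le> Re (cinner x (A *v x)) * t\<^sup>2 - 2 * t * s * (cmod (cinner x (A *v y)))\<^sup>2
      + s\<^sup>2 * Re (cinner y (A *v y)) * (cmod (cinner x (A *v y)))\<^sup>2"
    by (simp add: c_def)
qed (simp_all add: psd_cinner_nonneg[OF assms])

lemma psd_offdiag_le:
  assumes "psd A"
  shows "(cmod (A $ i $ j))\<^sup>2 \<le> Re (A $ i $ i) * Re (A $ j $ j)"
  using psd_Cauchy_Schwarz[OF assms, of "axis i 1" "axis j 1"] by (simp add: cinner_matrix_axis)

lemma norm_psd_le_trace:
  assumes psd_A: "psd A"
  shows "norm A \<le> Re (trace A)"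
proof (rule power2_le_imp_le)
  have "(norm A)\<^sup>2 = (\<Sum>i\<in>UNIV. \<Sum>j\<in>UNIV. (cmod (A $ i $ j))\<^sup>2)"
    by (simp add: norm_vec_def L2_set_def sum_nonneg)
  also have "\<dots> \<le> (\<Sum>i\<in>UNIV. \<Sum>j\<in>UNIV. Re (A $ i $ i) * Re (A $ j $ j))"
    by (intro sum_mono psd_offdiag_le psd_A)
  also have "\<dots> = (Re (trace A))\<^sup>2"
    by (simp add: trace_def power2_eq_square sum_product)
  finally show "(norm A)\<^sup>2 \<le> (Re (trace A))\<^sup>2" .
qed (rule psd_trace_nonneg[OF psd_A])

subsection \<open>Diagonalisation by congruence\<close>

definition pivot_mat :: "complex^'n^'n \<Rightarrow> 'n \<Rightarrow> complex^'n^'n" where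
  "pivot_mat M i =
    (\<chi> j k. (if j = k then 1 else 0) - (if k = i \<and> j \<noteq> i then M $ j $ i / M $ i $ i else 0))"

lemma det_pivot_mat:
  fixes M :: "complex^'n^'n"
  shows "det (pivot_mat M i) = 1"
proof -
  define r where "r = (\<chi> j. if j = i then 0 else - (M $ j $ i / M $ i $ i))"
  have "det (pivot_mat M i) = det (transpose (pivot_mat M i))"
    by simp
  also have "transpose (pivot_mat M i) = (\<chi> k. if k = i then row i (mat 1) + r else row k (mat 1))"
    by (auto simp: vec_eq_iff transpose_def pivot_mat_def r_def row_def mat_def)
  also have "det \<dots> = det (mat 1 :: complex^'n^'n)"
  proof (rule det_row_span)
    have "r = (\<Sum>j\<in>UNIV - {i}. r $ j *s row j (mat 1 :: complex^'n^'n))"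
      by (auto simp: vec_eq_iff row_def mat_def r_def if_distrib[of "\<lambda>x. _ * x"]
          sum_negf cong: if_cong)
    also have "\<dots> \<in> vec.span {row j (mat 1 :: complex^'n^'n) |j. j \<noteq> i}"
      by (intro vec.span_sum vec.span_scale vec.span_base) auto
    finally show "r \<in> vec.span {row j (mat 1 :: complex^'n^'n) |j. j \<noteq> i}" .
  qed
  finally show ?thesis by simp
qed

lemma pivot_mat_congruence_nth:
  assumes hermitian_M: "hermitian M" and pivot_nonzero: "M $ i $ i \<noteq> 0"
  shows "(pivot_mat M i ** M ** adjc (pivot_mat M i)) $ j $ k =
    (if j = i \<or> k = i then if j = k then M $ i $ i else 0
     else M $ j $ k - M $ j $ i * M $ i $ k / M $ i $ i)"
proof -
  define c where "c j = (if j = i then 0 else M $ j $ i / M $ i $ i)" for j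
  have pivot_mat_eq: "pivot_mat M i = (\<chi> j k. (if j = k then 1 else 0) - (if k = i then c j else 0))"
    by (auto simp: vec_eq_iff pivot_mat_def c_def)
  have mult_left: "(pivot_mat M i ** N) $ j $ k = N $ j $ k - c j * N $ i $ k" for N j k
    by (simp add: pivot_mat_eq matrix_matrix_mult_def algebra_simps sum_subtractf
        if_distrib[of "\<lambda>x. x * _"] if_distrib[of "\<lambda>x. _ * x"] cong: if_cong)
  have mult_right: "(N ** adjc (pivot_mat M i)) $ j $ k = N $ j $ k - N $ j $ i * cnj (c k)" for N j k
    by (simp add: pivot_mat_eq matrix_matrix_mult_def algebra_simps sum_subtractf if_distrib[of cnj]
        if_distrib[of "\<lambda>x. x * _"] if_distrib[of "\<lambda>x. _ * x"] cong: if_cong)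
  have "cnj (c k) = (if k = i then 0 else M $ i $ k / M $ i $ i)"
    using hermitian_nth[OF hermitian_M, of i k] hermitian_nth[OF hermitian_M, of i i]
    by (simp add: c_def)
  then show ?thesis
    using pivot_nonzero by (simp add: mult_left mult_right c_def field_simps)
qed

lemma psd_eliminate_index:
  fixes M :: "complex^'n^'n"
  assumes psd_M: "psd M" and S_cleared: "\<And>j k. j \<in> S \<Longrightarrow> k \<noteq> j \<Longrightarrow> M $ j $ k = 0"
  obtains L where "det L = 1"
    "\<And>j k. j \<in> insert i S \<Longrightarrow> k \<noteq> j \<Longrightarrow> (L ** M ** adjc L) $ j $ k = 0"
    "\<And>j. Re ((L ** M ** adjc L) $ j $ j) \<le> Re (M $ j $ j)"
proof (cases "M $ i $ i = 0")
  case True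
  have "M $ i $ k = 0" for k
    using psd_offdiag_le[OF psd_M, of i k] True by simp
  then show ?thesis
    using S_cleared by (intro that[of "mat 1"]) auto
next
  case False
  note entry = pivot_mat_congruence_nth[OF psd_hermitian[OF psd_M] False]
  have "0 \<le> Re (M $ j $ i * M $ i $ j / M $ i $ i)" for j
  proof -
    have "M $ j $ i * M $ i $ j / M $ i $ i = (M $ j $ i * cnj (M $ j $ i)) / of_real (Re (M $ i $ i))"
      by (metis hermitian_nth hermitian_diag psd_hermitian[OF psd_M])
    also have "Re \<dots> = (cmod (M $ j $ i))\<^sup>2 / Re (M $ i $ i)"
      by (simp flip: complex_norm_square)
    also have "\<dots> \<ge> 0"
      by (intro divide_nonneg_nonneg psd_diag_nonneg psd_M) simp
    finally show ?thesis .
  qed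
  then show ?thesis
    using S_cleared by (intro that[of "pivot_mat M i"] det_pivot_mat) (auto simp: entry)
qed

lemma psd_eliminate_indices:
  fixes M :: "complex^'n^'n"
  assumes psd_M: "psd M" and "finite S"
  obtains L where "det L = 1"
    "\<And>j k. j \<in> S \<Longrightarrow> k \<noteq> j \<Longrightarrow> (L ** M ** adjc L) $ j $ k = 0"
    "\<And>j. Re ((L ** M ** adjc L) $ j $ j) \<le> Re (M $ j $ j)"
  using \<open>finite S\<close>
proof (induction S arbitrary: thesis rule: finite_induct)
  case empty
  show ?case
    by (rule empty[of "mat 1"]) simp_all
next
  case (insert i S)
  obtain L where L_clears_S: "det L = 1" "\<And>j k. j \<in> S \<Longrightarrow> k \<noteq> j \<Longrightarrow> (L ** M ** adjc L) $ j $ k = 0"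
    "\<And>j. Re ((L ** M ** adjc L) $ j $ j) \<le> Re (M $ j $ j)"
    by (rule insert.IH) (rule that)
  obtain L' where L'_clears_insert: "det L' = 1"
    "\<And>j k. j \<in> insert i S \<Longrightarrow> k \<noteq> j \<Longrightarrow> (L' ** (L ** M ** adjc L) ** adjc L') $ j $ k = 0"
    "\<And>j. Re ((L' ** (L ** M ** adjc L) ** adjc L') $ j $ j) \<le> Re ((L ** M ** adjc L) $ j $ j)"
    using psd_eliminate_index[OF psd_congruence[OF psd_M, of L], of S i] L_clears_S(2) by metis
  have "L' ** (L ** M ** adjc L) ** adjc L' = (L' ** L) ** M ** adjc (L' ** L)"
    by (simp add: adjc_mult matrix_mul_assoc)
  then show ?case
    using L_clears_S L'_clears_insert
    by (intro insert.prems[of "L' ** L"]) (fastforce simp: det_mul intro: order_trans)+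
qed

lemma psd_congruent_diag_mat:
  fixes M :: "complex^'n^'n"
  assumes psd_M: "psd M"
  obtains L d where "det L = 1" "L ** M ** adjc L = diag_mat (\<lambda>i. of_real (d i))"
    "\<And>i. 0 \<le> d i" "\<And>i. d i \<le> Re (M $ i $ i)"
proof -
  obtain L where L_diagonalises: "det L = 1" "\<And>j k. k \<noteq> j \<Longrightarrow> (L ** M ** adjc L) $ j $ k = 0"
    "\<And>j. Re ((L ** M ** adjc L) $ j $ j) \<le> Re (M $ j $ j)"
    using psd_eliminate_indices[OF psd_M finite_class.finite_UNIV] by auto
  have psd_congruent: "psd (L ** M ** adjc L)"
    by (rule psd_congruence[OF psd_M])
  have "L ** M ** adjc L = diag_mat (\<lambda>i. of_real (Re ((L ** M ** adjc L) $ i $ i)))"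
    using L_diagonalises(2) hermitian_diag[OF psd_hermitian[OF psd_congruent]]
    by (auto simp: vec_eq_iff)
  with L_diagonalises show ?thesis
    using psd_diag_nonneg[OF psd_congruent] by (intro that[of L])
qed

lemma psd_eq_congruence_diag_mat:
  fixes B :: "complex^'n^'n"
  assumes "psd B"
  obtains K :: "complex^'n^'n" and d
  where "B = K ** diag_mat (\<lambda>i. of_real (d i)) ** adjc K" "\<And>i. 0 \<le> d i"
proof -
  obtain L d where L_diagonalises: "det L = 1" "L ** B ** adjc L = diag_mat (\<lambda>i. of_real (d i))"
    and d_nonneg: "\<And>i. 0 \<le> d i"
    using psd_congruent_diag_mat[OF assms] by metis
  obtain K where K_left_inverse: "K ** L = mat 1"
    using L_diagonalises(1) by (metis invertible_det_nz invertible_left_inverse zero_neq_one)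
  then have adjc_K_right_inverse: "adjc L ** adjc K = mat 1"
    by (metis adjc_mat_1 adjc_mult)
  have "K ** (L ** B ** adjc L) ** adjc K = (K ** L) ** B ** (adjc L ** adjc K)"
    by (simp add: matrix_mul_assoc)
  with d_nonneg show ?thesis
    by (intro that[of K d]) (simp_all add: K_left_inverse adjc_K_right_inverse L_diagonalises(2))
qed

lemma det_congruence: "det L = 1 \<Longrightarrow> det (L ** M ** adjc L) = det M"
  by (simp add: det_mul det_adjc)

lemma det_of_congruent_diag_mat:
  assumes "det L = 1" and "L ** M ** adjc L = diag_mat (\<lambda>i. of_real (d i))"
  shows "det M = of_real (\<Prod>i\<in>UNIV. d i)"
  using det_congruence[OF assms(1), of M] by (simp add: assms(2) det_diag_mat)

lemma inner_psd_nonneg: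
  fixes A B :: "complex^'n^'n"
  assumes "psd A" "psd B"
  shows "0 \<le> inner A B"
proof -
  obtain K :: "complex^'n^'n" and d where B_eq: "B = K ** diag_mat (\<lambda>i. of_real (d i)) ** adjc K"
    and d_nonneg: "\<And>i. 0 \<le> d i"
    using psd_eq_congruence_diag_mat[OF \<open>psd B\<close>] by metis
  have "psd (adjc K ** A ** K)"
    using psd_congruence[OF \<open>psd A\<close>, of "adjc K"] by simp
  then have "0 \<le> inner (diag_mat (\<lambda>i. of_real (d i))) (adjc K ** A ** K)"
    unfolding inner_diag_mat by (intro sum_nonneg mult_nonneg_nonneg d_nonneg psd_diag_nonneg)
  also have "\<dots> = inner A B"
    unfolding B_eq inner_congruence by (rule inner_commute)
  finally show ?thesis .
qed

lemma psd_det_pos: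
  assumes "psd M" "det M \<noteq> 0"
  shows "0 < Re (det M)"
proof -
  obtain L d where "det L = 1" "L ** M ** adjc L = diag_mat (\<lambda>i. of_real (d i))"
    and d_nonneg: "\<And>i. 0 \<le> d i"
    using psd_congruent_diag_mat[OF assms(1)] by metis
  then have "det M = of_real (\<Prod>i\<in>UNIV. d i)"
    by (intro det_of_congruent_diag_mat)
  moreover have "0 \<le> (\<Prod>i\<in>UNIV. d i)"
    using d_nonneg by (intro prod_nonneg)
  ultimately show ?thesis
    using assms(2) by (simp add: less_le del: of_real_prod)
qed

lemma Hadamard_inequality:
  assumes "psd M"
  shows "Re (det M) \<le> (\<Prod>i\<in>UNIV. Re (M $ i $ i))"
proof -
  obtain L d where "det L = 1" "L ** M ** adjc L = diag_mat (\<lambda>i. of_real (d i))"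
    and d_bounds: "\<And>i. 0 \<le> d i" "\<And>i. d i \<le> Re (M $ i $ i)"
    using psd_congruent_diag_mat[OF assms] by metis
  then have "det M = of_real (\<Prod>i\<in>UNIV. d i)"
    by (intro det_of_congruent_diag_mat)
  also have "Re \<dots> = (\<Prod>i\<in>UNIV. d i)"
    by (rule Re_complex_of_real)
  also have "\<dots> \<le> (\<Prod>i\<in>UNIV. Re (M $ i $ i))"
    using d_bounds by (intro prod_mono) auto
  finally show ?thesis .
qed

lemma psd_diag_pos:
  assumes "psd M" "det M \<noteq> 0"
  shows "0 < Re (M $ i $ i)"
proof -
  have "0 < (\<Prod>i\<in>UNIV. Re (M $ i $ i))"
    using psd_det_pos[OF assms] Hadamard_inequality[OF assms(1)] by simp
  then have "Re (M $ i $ i) \<noteq> 0"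
    by (metis UNIV_I finite less_irrefl prod_zero)
  then show ?thesis
    using psd_diag_nonneg[OF assms(1), of i] by simp
qed

lemma inner_matrix_inv_of_congruent_diag:
  fixes L P N :: "complex^'n^'n"
  assumes "L ** P ** adjc L = diag_mat (\<lambda>i. of_real (d i))" and "\<And>i. d i \<noteq> 0"
  shows "inner (matrix_inv P) N = (\<Sum>i\<in>UNIV. Re ((L ** N ** adjc L) $ i $ i) / d i)"
proof -
  have "matrix_inv P = adjc L ** diag_mat (\<lambda>i. of_real (1 / d i)) ** L"
    using matrix_inv_of_congruent_diag[OF assms(1)] assms(2) by simp
  then have "inner (matrix_inv P) N = inner (diag_mat (\<lambda>i. of_real (1 / d i))) (L ** N ** adjc L)"
    by (simp add: inner_congruence)
  then show ?thesis
    unfolding inner_diag_mat by simp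
qed

text \<open>A congruence makes \<open>P\<close> diagonal; Hadamard's inequality for the transformed \<open>P'\<close> then reduces
  the tangent bound to \<open>ln t \<le> t - 1\<close> on the diagonal.\<close>

lemma ln_det_tangent:
  fixes P_nonsingular P'_nonsingular :: "complex^'n^'n"
  assumes P_nonsingular: "psd P" "det P \<noteq> 0" and P'_nonsingular: "psd P'" "det P' \<noteq> 0"
  shows "ln (Re (det P')) \<le> ln (Re (det P)) + inner (matrix_inv P) (P' - P)"
proof -
  obtain L d where det_L: "det L = 1" and diagonal: "L ** P ** adjc L = diag_mat (\<lambda>i. of_real (d i))"
    using psd_congruent_diag_mat[OF P_nonsingular(1)] by metis
  define M where "M = L ** P' ** adjc L"
  have "0 < Re ((L ** P ** adjc L) $ i $ i)" for i
    using P_nonsingular det_L by (intro psd_diag_pos psd_congruence) (simp_all add: det_congruence)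
  then have d_pos: "0 < d i" for i
    by (simp add: diagonal)
  have psd_M: "psd M" and det_M: "det M = det P'"
    using P'_nonsingular det_L by (simp_all add: M_def psd_congruence det_congruence)
  have M_diag_pos: "0 < Re (M $ i $ i)" for i
    using psd_M det_M P'_nonsingular by (intro psd_diag_pos) simp_all
  have "ln (Re (det P')) \<le> ln (\<Prod>i\<in>UNIV. Re (M $ i $ i))"
    using Hadamard_inequality[OF psd_M] psd_det_pos[OF P'_nonsingular] by (simp add: det_M)
  also have "\<dots> = (\<Sum>i\<in>UNIV. ln (Re (M $ i $ i)))"
    using M_diag_pos by (intro ln_prod) (simp_all add: less_imp_neq[symmetric])
  also have "\<dots> \<le> (\<Sum>i\<in>UNIV. ln (d i) + Re ((M - diag_mat (\<lambda>i. of_real (d i))) $ i $ i) / d i)"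
  proof (rule sum_mono)
    fix i
    have "ln (Re (M $ i $ i) / d i) \<le> Re (M $ i $ i) / d i - 1"
      using d_pos M_diag_pos by (intro ln_le_minus_one) simp
    then show "ln (Re (M $ i $ i)) \<le> ln (d i) + Re ((M - diag_mat (\<lambda>i. of_real (d i))) $ i $ i) / d i"
      using d_pos[of i] M_diag_pos[of i] by (simp add: ln_div diff_divide_distrib)
  qed
  also have "\<dots> = ln (Re (det P)) + (\<Sum>i\<in>UNIV. Re ((M - diag_mat (\<lambda>i. of_real (d i))) $ i $ i) / d i)"
    using d_pos by (simp add: det_of_congruent_diag_mat[OF det_L diagonal] sum.distrib ln_prod
        less_imp_neq[symmetric] del: of_real_prod)
  also have "M - diag_mat (\<lambda>i. of_real (d i)) = L ** (P' - P) ** adjc L"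
    by (simp add: M_def matrix_mult_diff_left matrix_mult_diff_right flip: diagonal)
  also have "(\<Sum>i\<in>UNIV. Re ((L ** (P' - P) ** adjc L) $ i $ i) / d i) = inner (matrix_inv P) (P' - P)"
    using inner_matrix_inv_of_congruent_diag[OF diagonal] d_pos
    by (simp add: less_imp_neq[symmetric])
  finally show ?thesis .
qed

section \<open>Continuity of matrix operations\<close>

lemma continuous_on_matrix_mult:
  fixes A :: "'t::topological_space \<Rightarrow> 'a::real_normed_field^'n^'m" and B :: "'t \<Rightarrow> 'a^'p^'n"
  assumes "continuous_on S A" "continuous_on S B"
  shows "continuous_on S (\<lambda>x. A x ** B x)"
  unfolding matrix_matrix_mult_def
  by (intro continuous_on_vec_lambda continuous_intros assms)

lemma continuous_on_trace:
  fixes A :: "'t::topological_space \<Rightarrow> 'a::real_normed_field^'n^'n"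
  assumes "continuous_on S A"
  shows "continuous_on S (\<lambda>x. trace (A x))"
  unfolding trace_def by (intro continuous_intros assms)

lemma continuous_on_det:
  fixes A :: "'t::topological_space \<Rightarrow> 'a::real_normed_field^'n^'n"
  assumes "continuous_on S A"
  shows "continuous_on S (\<lambda>x. det (A x))"
  unfolding det_def by (intro continuous_intros assms)

lemma matrix_inv_cramer:
  fixes A :: "'a::field^'n^'n"
  assumes "det A \<noteq> 0"
  shows "matrix_inv A $ k $ l =
    det (\<chi> i j. if j = k then (if i = l then 1 else 0) else A $ i $ j) / det A"
proof -
  have "A *v (\<chi> m. matrix_inv A $ m $ l) = (\<chi> i. if i = l then 1 else 0)"
    using matrix_inv_right[OF assms]
    by (simp add: vec_eq_iff matrix_matrix_mult_def matrix_vector_mult_def mat_def)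
  then have "(\<chi> m. matrix_inv A $ m $ l) =
      (\<chi> k. det (\<chi> i j. if j = k then (\<chi> i. if i = l then 1 else 0) $ i else A $ i $ j) / det A)"
    using cramer[OF assms] by blast
  then show ?thesis
    by (simp add: vec_eq_iff cong: if_cong)
qed

lemma continuous_on_matrix_inv:
  fixes A :: "'t::topological_space \<Rightarrow> 'a::real_normed_field^'n^'n"
  assumes A_continuous: "continuous_on S A" and det_nonzero: "\<And>x. x \<in> S \<Longrightarrow> det (A x) \<noteq> 0"
  shows "continuous_on S (\<lambda>x. matrix_inv (A x))"
proof (rule continuous_on_eq)
  show "continuous_on S (\<lambda>x. \<chi> k l.
      det (\<chi> i j. if j = k then (if i = l then 1 else 0) else A x $ i $ j) / det (A x))"
  proof (intro continuous_on_vec_lambda continuous_on_divide continuous_on_det A_continuous)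
    fix k l i j
    show "continuous_on S (\<lambda>x. if j = k then (if i = l then 1 else 0) else A x $ i $ j)"
      by (cases "j = k") (auto intro!: continuous_intros A_continuous)
  qed (use det_nonzero in auto)
qed (simp add: vec_eq_iff matrix_inv_cramer det_nonzero)

section \<open>Square-integrable random vectors\<close>

definition square_integrable :: "'w measure \<Rightarrow> ('w \<Rightarrow> 'a::euclidean_space) \<Rightarrow> bool" where
  "square_integrable M f \<longleftrightarrow> f \<in> borel_measurable M \<and> integrable M (\<lambda>x. (norm (f x))\<^sup>2)"

lemma square_integrable_measurable: "square_integrable M f \<Longrightarrow> f \<in> borel_measurable M"
  by (simp add: square_integrable_def)

lemma square_integrable_bound:
  assumes "square_integrable M f" and [measurable]: "g \<in> borel_measurable M"
    and "\<And>x. x \<in> space M \<Longrightarrow> norm (g x) \<le> c * norm (f x)"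
  shows "square_integrable M g"
proof -
  have "integrable M (\<lambda>x. c\<^sup>2 * (norm (f x))\<^sup>2)"
    using assms(1) by (simp add: square_integrable_def)
  then have "integrable M (\<lambda>x. (norm (g x))\<^sup>2)"
  proof (rule Bochner_Integration.integrable_bound)
    have "(norm (g x))\<^sup>2 \<le> c\<^sup>2 * (norm (f x))\<^sup>2" if "x \<in> space M" for x
      using power_mono[OF assms(3)[OF that], of 2] by (simp add: power_mult_distrib)
    then show "AE x in M. norm ((norm (g x))\<^sup>2) \<le> norm (c\<^sup>2 * (norm (f x))\<^sup>2)"
      by (simp add: abs_mult)
  qed simp
  then show ?thesis
    by (simp add: square_integrable_def)
qed

lemma (in finite_measure) square_integrable_const_bound:
  fixes f :: "'a \<Rightarrow> 'b::euclidean_space"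
  assumes [measurable]: "f \<in> borel_measurable M" and "\<And>x. x \<in> space M \<Longrightarrow> norm (f x) \<le> c"
  shows "square_integrable M f"
proof -
  have "square_integrable M (\<lambda>_. 1 :: real)"
    by (simp add: square_integrable_def)
  then show ?thesis
    by (rule square_integrable_bound[where c = c]) (use assms in auto)
qed

lemma square_integrable_norm: "square_integrable M f \<Longrightarrow> square_integrable M (\<lambda>x. norm (f x))"
  by (auto simp: square_integrable_def intro: borel_measurable_norm)

lemma norm_add_power2_le:
  fixes a b :: "'a::real_normed_vector"
  shows "(norm (a + b))\<^sup>2 \<le> 2 * (norm a)\<^sup>2 + 2 * (norm b)\<^sup>2"
proof -
  have "(norm (a + b))\<^sup>2 \<le> (norm a + norm b)\<^sup>2"
    by (intro power_mono norm_triangle_ineq) simp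
  then show ?thesis
    using sum_squares_bound[of "norm a" "norm b"] by (simp add: power2_sum)
qed

lemma square_integrable_add:
  assumes f_square_integrable: "square_integrable M f" and g_square_integrable: "square_integrable M g"
  shows "square_integrable M (\<lambda>x. f x + g x)"
proof -
  have [measurable]: "f \<in> borel_measurable M" "g \<in> borel_measurable M"
    using f_square_integrable g_square_integrable by (auto dest: square_integrable_measurable)
  have "integrable M (\<lambda>x. 2 * (norm (f x))\<^sup>2 + 2 * (norm (g x))\<^sup>2)"
    using f_square_integrable g_square_integrable by (simp add: square_integrable_def)
  then have "integrable M (\<lambda>x. (norm (f x + g x))\<^sup>2)"
    by (rule Bochner_Integration.integrable_bound) (auto intro: norm_add_power2_le order_trans)
  then show ?thesis
    by (simp add: square_integrable_def)
qed

lemma square_integrable_sum: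
  assumes "\<And>i. i \<in> I \<Longrightarrow> square_integrable M (f i)"
  shows "square_integrable M (\<lambda>x. \<Sum>i\<in>I. f i x)"
  using assms
  by (induction I rule: infinite_finite_induct)
    (auto simp: square_integrable_add, simp_all add: square_integrable_def)

lemma square_integrable_scaleR:
  assumes "square_integrable M f"
  shows "square_integrable M (\<lambda>x. c *\<^sub>R f x)"
  using assms
  by (auto simp: square_integrable_def power_mult_distrib intro: borel_measurable_scaleR)

lemma integrable_inner_of_square_integrable:
  assumes f_square_integrable: "square_integrable M f" and g_square_integrable: "square_integrable M g"
  shows "integrable M (\<lambda>x. inner (f x) (g x))"
proof (rule Bochner_Integration.integrable_bound)
  show "integrable M (\<lambda>x. (norm (f x))\<^sup>2 + (norm (g x))\<^sup>2)"
    using f_square_integrable g_square_integrable by (simp add: square_integrable_def)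
  have "\<bar>inner a b\<bar> \<le> (norm a)\<^sup>2 + (norm b)\<^sup>2" for a b :: 'b
    using Cauchy_Schwarz_ineq2[of a b] sum_squares_bound[of "norm a" "norm b"]
      mult_nonneg_nonneg[of "norm a" "norm b"] by (simp add: mult.assoc)
  then show "AE x in M. norm (inner (f x) (g x)) \<le> norm ((norm (f x))\<^sup>2 + (norm (g x))\<^sup>2)"
    by simp
  show "(\<lambda>x. inner (f x) (g x)) \<in> borel_measurable M"
    using f_square_integrable g_square_integrable
    by (intro borel_measurable_inner square_integrable_measurable)
qed

lemma abs_inner_le_of_norm_le:
  assumes "norm b \<le> c"
  shows "\<bar>inner a b\<bar> \<le> c * norm a"
  using Cauchy_Schwarz_ineq2[of a b] mult_left_mono[OF assms norm_ge_zero[of a]]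
  by (simp add: mult.commute)

lemma square_integrable_inner_bounded:
  assumes f_square_integrable: "square_integrable M f"
    and w_bounded: "w \<in> borel_measurable M" "\<And>x. x \<in> space M \<Longrightarrow> norm (w x) \<le> c"
  shows "square_integrable M (\<lambda>x. inner (f x) (w x))"
proof (rule square_integrable_bound[OF f_square_integrable, where c = c])
  show "(\<lambda>x. inner (f x) (w x)) \<in> borel_measurable M"
    by (intro borel_measurable_inner square_integrable_measurable[OF f_square_integrable] w_bounded)
qed (use w_bounded(2) in \<open>simp add: abs_inner_le_of_norm_le\<close>)

lemma second_moment_inner_bounded_le:
  assumes f_square_integrable: "square_integrable M f"
    and w_bounded: "w \<in> borel_measurable M" "\<And>x. x \<in> space M \<Longrightarrow> norm (w x) \<le> c"
  shows "(\<integral>x. (inner (f x) (w x))\<^sup>2 \<partial>M) \<le> c\<^sup>2 * (\<integral>x. (norm (f x))\<^sup>2 \<partial>M)"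
proof -
  have "(\<integral>x. (inner (f x) (w x))\<^sup>2 \<partial>M) \<le> (\<integral>x. c\<^sup>2 * (norm (f x))\<^sup>2 \<partial>M)"
  proof (rule integral_mono)
    show "integrable M (\<lambda>x. (inner (f x) (w x))\<^sup>2)"
      using square_integrable_inner_bounded[OF f_square_integrable w_bounded]
      by (simp add: square_integrable_def)
    show "integrable M (\<lambda>x. c\<^sup>2 * (norm (f x))\<^sup>2)"
      using f_square_integrable by (simp add: square_integrable_def)
    fix x assume "x \<in> space M"
    then have "\<bar>inner (f x) (w x)\<bar>\<^sup>2 \<le> (c * norm (f x))\<^sup>2"
      by (intro power_mono abs_inner_le_of_norm_le w_bounded) simp_all
    then show "(inner (f x) (w x))\<^sup>2 \<le> c\<^sup>2 * (norm (f x))\<^sup>2"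
      by (simp add: power_mult_distrib)
  qed
  then show ?thesis
    by simp
qed

lemma square_integrable_inner_const:
  assumes "square_integrable M f"
  shows "square_integrable M (\<lambda>x. inner (f x) b)"
  using assms by (rule square_integrable_inner_bounded[where c = "norm b"]) auto

lemma (in finite_measure) integrable_inner_const_of_square_integrable:
  assumes "square_integrable M f"
  shows "integrable M (\<lambda>x. inner (f x) b)"
  by (rule integrable_inner_of_square_integrable[OF assms square_integrable_const_bound]) auto

lemma second_moment_sum_orthogonal:
  assumes square_integrable: "\<And>n. n \<in> I \<Longrightarrow> square_integrable M (\<xi> n)"
    and orthogonal: "\<And>m n. m \<in> I \<Longrightarrow> n \<in> I \<Longrightarrow> m \<noteq> n \<Longrightarrow> (\<integral>x. inner (\<xi> m x) (\<xi> n x) \<partial>M) = 0"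
    and "finite I"
  shows "(\<integral>x. (norm (\<Sum>n\<in>I. \<xi> n x))\<^sup>2 \<partial>M) = (\<Sum>n\<in>I. \<integral>x. (norm (\<xi> n x))\<^sup>2 \<partial>M)"
proof -
  have inner_integrable: "integrable M (\<lambda>x. inner (\<xi> m x) (\<xi> n x))" if "m \<in> I" "n \<in> I" for m n
    using that by (intro integrable_inner_of_square_integrable square_integrable)
  have "(\<integral>x. (norm (\<Sum>n\<in>I. \<xi> n x))\<^sup>2 \<partial>M) = (\<integral>x. (\<Sum>m\<in>I. \<Sum>n\<in>I. inner (\<xi> n x) (\<xi> m x)) \<partial>M)"
    by (simp add: power2_norm_eq_inner inner_sum_left inner_sum_right)
  also have "\<dots> = (\<Sum>m\<in>I. \<Sum>n\<in>I. \<integral>x. inner (\<xi> n x) (\<xi> m x) \<partial>M)"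
    using inner_integrable by (simp add: Bochner_Integration.integral_sum)
  also have "\<dots> = (\<Sum>m\<in>I. \<Sum>n\<in>I. if m = n then \<integral>x. (norm (\<xi> m x))\<^sup>2 \<partial>M else 0)"
    using orthogonal by (intro sum.cong refl) (auto simp: power2_norm_eq_inner)
  also have "\<dots> = (\<Sum>n\<in>I. \<integral>x. (norm (\<xi> n x))\<^sup>2 \<partial>M)"
    using \<open>finite I\<close> by simp
  finally show ?thesis .
qed

lemma second_moment_sum_norm_le:
  assumes square_integrable: "\<And>n. n \<in> I \<Longrightarrow> square_integrable M (\<xi> n)"
    and second_moment_le: "\<And>n. n \<in> I \<Longrightarrow> (\<integral>x. (norm (\<xi> n x))\<^sup>2 \<partial>M) \<le> K"
  shows "(\<integral>x. (\<Sum>n\<in>I. norm (\<xi> n x))\<^sup>2 \<partial>M) \<le> (real (card I))\<^sup>2 * K"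
proof -
  have "(\<integral>x. (\<Sum>n\<in>I. norm (\<xi> n x))\<^sup>2 \<partial>M) \<le> (\<integral>x. real (card I) * (\<Sum>n\<in>I. (norm (\<xi> n x))\<^sup>2) \<partial>M)"
  proof (rule integral_mono)
    have "square_integrable M (\<lambda>x. \<Sum>n\<in>I. norm (\<xi> n x))"
      by (intro square_integrable_sum square_integrable_norm square_integrable)
    then show "integrable M (\<lambda>x. (\<Sum>n\<in>I. norm (\<xi> n x))\<^sup>2)"
      by (simp add: square_integrable_def)
    show "integrable M (\<lambda>x. real (card I) * (\<Sum>n\<in>I. (norm (\<xi> n x))\<^sup>2))"
      using square_integrable by (intro integrable_mult_right Bochner_Integration.integrable_sum)
        (simp add: square_integrable_def)
  qed (use sum_squared_le_sum_of_squares in \<open>simp add: mult.commute\<close>)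
  also have "\<dots> = real (card I) * (\<Sum>n\<in>I. \<integral>x. (norm (\<xi> n x))\<^sup>2 \<partial>M)"
    using square_integrable by (simp add: square_integrable_def Bochner_Integration.integral_sum)
  also have "\<dots> \<le> real (card I) * (\<Sum>n\<in>I. K)"
    using second_moment_le by (intro mult_left_mono sum_mono) auto
  finally show ?thesis
    by (simp add: power2_eq_square mult.assoc)
qed

subsection \<open>Moments from tail bounds\<close>

lemma powr_le_dyadic_layers:
  assumes z_nonneg: "0 \<le> z" and p_pos: "0 < p"
  shows "ennreal (z powr p) \<le> 1 + (\<Sum>k. ennreal (2 powr (p * real (Suc k))) * indicator {2 ^ k..} z)"
proof (cases "z < 1")
  case True
  then have "z powr p \<le> 1"
    using z_nonneg p_pos powr_mono2[of p z 1] by simp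
  then have "ennreal (z powr p) \<le> 1"
    by simp
  then show ?thesis
    by (simp add: add_increasing2)
next
  case False
  define k where "k = nat \<lfloor>log 2 z\<rfloor>"
  have "0 \<le> \<lfloor>log 2 z\<rfloor>"
    using False by simp
  then have "real k \<le> log 2 z" "log 2 z < real (Suc k)"
    by (auto simp: k_def) linarith
  then have lower: "2 ^ k \<le> z" and upper: "z \<le> 2 powr real (Suc k)"
    using False by (auto simp: le_log_iff log_less_iff powr_realpow simp del: of_nat_Suc)
  let ?layer = "\<lambda>k. ennreal (2 powr (p * real (Suc k))) * indicator {2 ^ k..} z"
  have "z powr p \<le> (2 powr real (Suc k)) powr p"
    using upper z_nonneg p_pos by (intro powr_mono2) simp_all
  then have "ennreal (z powr p) \<le> ?layer k"
    using lower by (simp add: powr_powr mult.commute ennreal_leI del: of_nat_Suc)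
  also have "\<dots> \<le> suminf ?layer"
  proof -
    have "f k \<le> suminf f" for f :: "nat \<Rightarrow> ennreal"
      using sum_le_suminf[of f "{k}"] by (simp add: summableI)
    then show ?thesis .
  qed
  finally show ?thesis
    by (simp add: add_increasing)
qed

lemma nn_integral_powr_le_dyadic_layers:
  assumes [measurable]: "Z \<in> borel_measurable M" and nonneg: "\<And>x. 0 \<le> Z x" and "0 < p"
  shows "(\<integral>\<^sup>+x. ennreal (Z x powr p) \<partial>M) \<le>
    emeasure M (space M) +
    (\<Sum>k. ennreal (2 powr (p * real (Suc k))) * emeasure M {x \<in> space M. 2 ^ k \<le> Z x})"
proof -
  define A where "A k = {x \<in> space M. 2 ^ k \<le> Z x}" for k :: nat
  have [measurable]: "A k \<in> sets M" for k
    unfolding A_def by measurable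
  have "(\<integral>\<^sup>+x. ennreal (Z x powr p) \<partial>M) \<le>
      (\<integral>\<^sup>+x. 1 + (\<Sum>k. ennreal (2 powr (p * real (Suc k))) * indicator (A k) x) \<partial>M)"
  proof (rule nn_integral_mono)
    fix x assume "x \<in> space M"
    then have "indicator {2 ^ k..} (Z x) = (indicator (A k) x :: ennreal)" for k
      by (simp add: A_def indicator_def)
    then show "ennreal (Z x powr p) \<le> 1 + (\<Sum>k. ennreal (2 powr (p * real (Suc k))) * indicator (A k) x)"
      using powr_le_dyadic_layers[OF nonneg \<open>0 < p\<close>, of x] by simp
  qed
  also have "\<dots> = emeasure M (space M) + (\<Sum>k. ennreal (2 powr (p * real (Suc k))) * emeasure M (A k))"
    by (simp add: nn_integral_add nn_integral_suminf nn_integral_cmult del: of_nat_Suc)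
  finally show ?thesis
    by (simp add: A_def)
qed

lemma (in prob_space) moment_of_tail:
  fixes Z :: "'a \<Rightarrow> real"
  assumes Z_measurable [measurable]: "Z \<in> borel_measurable M" and nonneg: "\<And>x. 0 \<le> Z x"
    and p_bounds: "0 < p" "p < \<beta>" and "0 \<le> B"
    and tail: "\<And>z. 0 < z \<Longrightarrow> prob {x \<in> space M. z \<le> Z x} \<le> B / z powr \<beta>"
  shows "integrable M (\<lambda>x. Z x powr p)"
    and "expectation (\<lambda>x. Z x powr p) \<le> 1 + 2 powr p * B / (1 - 2 powr (p - \<beta>))"
proof -
  define q where "q = 2 powr (p - \<beta>)"
  have q_bounds: "0 < q" "q < 1"
    using p_bounds powr_less_mono[of "p - \<beta>" 0 2] by (simp_all add: q_def)
  have layer_le: "ennreal (2 powr (p * real (Suc k))) * emeasure M {x \<in> space M. 2 ^ k \<le> Z x} \<le>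
      ennreal (2 powr p * B * q ^ k)" for k
  proof -
    have "2 powr (p * real (Suc k)) * prob {x \<in> space M. 2 ^ k \<le> Z x} \<le>
        2 powr (p * real (Suc k)) * (B / (2 ^ k) powr \<beta>)"
      using tail[of "2 ^ k"] by (intro mult_left_mono) auto
    also have "\<dots> = 2 powr p * B * q ^ k"
      by (simp add: q_def powr_powr powr_diff powr_add distrib_left mult.commute power_divide
          flip: powr_realpow)
    finally show ?thesis
      by (simp add: emeasure_eq_measure ennreal_leI flip: ennreal_mult del: of_nat_Suc)
  qed
  note nn_integral_powr_le_dyadic_layers[OF Z_measurable nonneg p_bounds(1)]
  also have "emeasure M (space M)
      + (\<Sum>k. ennreal (2 powr (p * real (Suc k))) * emeasure M {x \<in> space M. 2 ^ k \<le> Z x}) \<le>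
      1 + (\<Sum>k. ennreal (2 powr p * B * q ^ k))"
    unfolding emeasure_space_1 by (intro add_left_mono suminf_le summableI layer_le)
  also have "(\<Sum>k. ennreal (2 powr p * B * q ^ k)) = ennreal (2 powr p * B * (1 / (1 - q)))"
    using q_bounds \<open>0 \<le> B\<close> by (intro suminf_ennreal_eq sums_mult geometric_sums) auto
  also have "1 + \<dots> = ennreal (1 + 2 powr p * B / (1 - q))"
    using q_bounds \<open>0 \<le> B\<close> by (simp add: ennreal_plus del: ennreal_plus[symmetric])
  finally have nn_integral_le:
    "(\<integral>\<^sup>+x. ennreal (Z x powr p) \<partial>M) \<le> ennreal (1 + 2 powr p * B / (1 - q))" .
  then show integrable: "integrable M (\<lambda>x. Z x powr p)"
    by (intro integrableI_nonneg) (auto intro: le_less_trans)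
  have "0 \<le> 1 + 2 powr p * B / (1 - q)"
    using q_bounds \<open>0 \<le> B\<close> by simp
  with nn_integral_le show "expectation (\<lambda>x. Z x powr p) \<le> 1 + 2 powr p * B / (1 - 2 powr (p - \<beta>))"
    by (simp add: nn_integral_eq_integral[OF integrable] q_def)
qed

lemma (in prob_space) square_integrable_of_tail:
  fixes f :: "'a \<Rightarrow> 'b::euclidean_space"
  assumes "f \<in> borel_measurable M" and "2 < \<beta>" "0 \<le> B"
    and "\<And>z. 0 < z \<Longrightarrow> prob {x \<in> space M. z \<le> norm (f x)} \<le> B / z powr \<beta>"
  shows "square_integrable M f"
    and "expectation (\<lambda>x. (norm (f x))\<^sup>2) \<le> 1 + 4 * B / (1 - 2 powr (2 - \<beta>))"
  using moment_of_tail[of "\<lambda>x. norm (f x)" 2 \<beta> B] assms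
  by (simp_all add: square_integrable_def powr_numeral)

section \<open>Strong law of large numbers\<close>

lemma AE_summable_of_summable_integral:
  fixes Y :: "nat \<Rightarrow> 'w \<Rightarrow> real"
  assumes integrable: "\<And>n. integrable M (Y n)" and nonneg: "\<And>n x. 0 \<le> Y n x"
    and integral_le: "\<And>n. (\<integral>x. Y n x \<partial>M) \<le> c n" and c_summable: "summable c"
  shows "AE x in M. summable (\<lambda>n. Y n x)"
proof -
  have [measurable]: "Y n \<in> borel_measurable M" for n
    using integrable by auto
  have c_nonneg: "0 \<le> c n" for n
    using integral_le[of n] nonneg by (metis Bochner_Integration.integral_nonneg order_trans)
  have "(\<integral>\<^sup>+x. (\<Sum>n. ennreal (Y n x)) \<partial>M) = (\<Sum>n. \<integral>\<^sup>+x. ennreal (Y n x) \<partial>M)"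
    by (rule nn_integral_suminf) simp
  also have "\<dots> \<le> (\<Sum>n. ennreal (c n))"
    using integrable nonneg integral_le
    by (intro suminf_le summableI) (simp add: nn_integral_eq_integral ennreal_leI)
  also have "\<dots> = ennreal (\<Sum>n. c n)"
    by (rule suminf_ennreal2[OF c_nonneg c_summable])
  finally have "(\<integral>\<^sup>+x. (\<Sum>n. ennreal (Y n x)) \<partial>M) \<noteq> \<infinity>"
    by (auto simp: top_unique)
  then have "AE x in M. (\<Sum>n. ennreal (Y n x)) \<noteq> \<infinity>"
    by (intro nn_integral_PInf_AE) simp_all
  then show ?thesis
    by eventually_elim (auto intro: summable_suminf_not_top nonneg)
qed

lemma AE_tendsto_0_of_summable_second_moment:
  fixes Y :: "nat \<Rightarrow> 'w \<Rightarrow> 'a::euclidean_space"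
  assumes "\<And>n. square_integrable M (Y n)" and "\<And>n. (\<integral>x. (norm (Y n x))\<^sup>2 \<partial>M) \<le> c n" and "summable c"
  shows "AE x in M. (\<lambda>n. Y n x) \<longlonglongrightarrow> 0"
proof -
  have "AE x in M. summable (\<lambda>n. (norm (Y n x))\<^sup>2)"
    using assms
    by (intro AE_summable_of_summable_integral[where c = c]) (auto simp: square_integrable_def)
  then show ?thesis
  proof eventually_elim
    fix x assume "summable (\<lambda>n. (norm (Y n x))\<^sup>2)"
    from tendsto_real_sqrt[OF summable_LIMSEQ_zero[OF this]]
    show "(\<lambda>n. Y n x) \<longlonglongrightarrow> 0"
      by (simp add: tendsto_norm_zero_iff)
  qed
qed

lemma average_tendsto_0_of_squares:
  fixes a :: "nat \<Rightarrow> 'a::real_normed_vector"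
  assumes squares: "(\<lambda>k. (\<Sum>n<k\<^sup>2. a n) /\<^sub>R (real k)\<^sup>2) \<longlonglongrightarrow> 0"
    and blocks: "(\<lambda>k. (\<Sum>n = k\<^sup>2..<(Suc k)\<^sup>2. norm (a n)) /\<^sub>R (real k)\<^sup>2) \<longlonglongrightarrow> 0"
  shows "(\<lambda>T. (\<Sum>n<T. a n) /\<^sub>R real T) \<longlonglongrightarrow> 0"
proof -
  define b where "b k = norm ((\<Sum>n<k\<^sup>2. a n) /\<^sub>R (real k)\<^sup>2)
    + (\<Sum>n = k\<^sup>2..<(Suc k)\<^sup>2. norm (a n)) /\<^sub>R (real k)\<^sup>2" for k
  have "b \<longlonglongrightarrow> 0"
    unfolding b_def by (rule tendsto_add_zero[OF tendsto_norm_zero[OF squares] blocks])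
  moreover have "filterlim floor_sqrt sequentially sequentially"
    unfolding filterlim_at_top eventually_sequentially
    by (metis floor_sqrt_inverse_power2 mono_floor_sqrt')
  ultimately have b_floor_sqrt_tendsto_0: "(\<lambda>T. b (floor_sqrt T)) \<longlonglongrightarrow> 0"
    by (rule filterlim_compose)
  have "norm ((\<Sum>n<T. a n) /\<^sub>R real T) \<le> b (floor_sqrt T)" if T_pos: "1 \<le> T" for T
  proof -
    define k where "k = floor_sqrt T"
    have k_bounds: "1 \<le> k" "k\<^sup>2 \<le> T" "T < (Suc k)\<^sup>2"
      using T_pos by (auto simp: k_def Suc_floor_sqrt_power2_gt Suc_le_eq)
    have "(\<Sum>n<T. a n) = (\<Sum>n<k\<^sup>2. a n) + (\<Sum>n = k\<^sup>2..<T. a n)"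
      using sum.atLeastLessThan_concat[of 0 "k\<^sup>2" T a] k_bounds(2) by (simp add: atLeast0LessThan)
    moreover have "norm (\<Sum>n = k\<^sup>2..<T. a n) \<le> (\<Sum>n = k\<^sup>2..<(Suc k)\<^sup>2. norm (a n))"
      using k_bounds by (intro order_trans[OF norm_sum] sum_mono2) auto
    ultimately have "norm (\<Sum>n<T. a n) \<le> norm (\<Sum>n<k\<^sup>2. a n) + (\<Sum>n = k\<^sup>2..<(Suc k)\<^sup>2. norm (a n))"
      by (simp add: norm_triangle_le)
    then have "norm (\<Sum>n<T. a n) / real T \<le>
        (norm (\<Sum>n<k\<^sup>2. a n) + (\<Sum>n = k\<^sup>2..<(Suc k)\<^sup>2. norm (a n))) / (real k)\<^sup>2"
      using k_bounds
      by (intro frac_le) (auto intro!: add_nonneg_nonneg sum_nonneg simp flip: of_nat_power)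
    then show ?thesis
      by (simp add: b_def k_def divide_inverse_commute distrib_left)
  qed
  then show ?thesis
    by (intro Lim_null_comparison[OF _ b_floor_sqrt_tendsto_0] eventually_sequentiallyI[of 1])
qed

lemma summable_divide_square: "summable (\<lambda>k. c / (real k)\<^sup>2)"
  using summable_mult[OF inverse_power_summable[of 2, where 'a = real], of c]
  by (simp add: field_simps)

lemma AE_average_at_squares_tendsto_0:
  fixes \<xi> :: "nat \<Rightarrow> 'w \<Rightarrow> 'a::euclidean_space"
  assumes square_integrable: "\<And>n. square_integrable M (\<xi> n)"
    and second_moment_le: "\<And>n. (\<integral>x. (norm (\<xi> n x))\<^sup>2 \<partial>M) \<le> K"
    and orthogonal: "\<And>m n. m \<noteq> n \<Longrightarrow> (\<integral>x. inner (\<xi> m x) (\<xi> n x) \<partial>M) = 0"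
  shows "AE x in M. (\<lambda>k. (\<Sum>n<k\<^sup>2. \<xi> n x) /\<^sub>R (real k)\<^sup>2) \<longlonglongrightarrow> 0"
proof (rule AE_tendsto_0_of_summable_second_moment[OF _ _ summable_divide_square[of K]])
  fix k
  show "square_integrable M (\<lambda>x. (\<Sum>n<k\<^sup>2. \<xi> n x) /\<^sub>R (real k)\<^sup>2)"
    by (intro square_integrable_scaleR square_integrable_sum square_integrable)
  have "(\<integral>x. (norm (\<Sum>n<k\<^sup>2. \<xi> n x))\<^sup>2 \<partial>M) = (\<Sum>n<k\<^sup>2. \<integral>x. (norm (\<xi> n x))\<^sup>2 \<partial>M)"
    by (intro second_moment_sum_orthogonal square_integrable orthogonal) auto
  also have "\<dots> \<le> (real k)\<^sup>2 * K"
    using sum_bounded_above[of "{..<k\<^sup>2}", OF second_moment_le] by simp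
  finally have "(\<integral>x. (norm (\<Sum>n<k\<^sup>2. \<xi> n x))\<^sup>2 \<partial>M) / (real k)^4 \<le> (real k)\<^sup>2 * K / (real k)^4"
    by (rule divide_right_mono) simp
  then show "(\<integral>x. (norm ((\<Sum>n<k\<^sup>2. \<xi> n x) /\<^sub>R (real k)\<^sup>2))\<^sup>2 \<partial>M) \<le> K / (real k)\<^sup>2"
    by (cases "k = 0") (simp_all add: field_simps power2_eq_square power4_eq_xxxx)
qed

lemma AE_average_over_square_blocks_tendsto_0:
  fixes \<xi> :: "nat \<Rightarrow> 'w \<Rightarrow> 'a::euclidean_space"
  assumes square_integrable: "\<And>n. square_integrable M (\<xi> n)"
    and second_moment_le: "\<And>n. (\<integral>x. (norm (\<xi> n x))\<^sup>2 \<partial>M) \<le> K"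
  shows "AE x in M. (\<lambda>k. (\<Sum>n = k\<^sup>2..<(Suc k)\<^sup>2. norm (\<xi> n x)) /\<^sub>R (real k)\<^sup>2) \<longlonglongrightarrow> 0"
proof (rule AE_tendsto_0_of_summable_second_moment[OF _ _ summable_divide_square[of "9 * K"]])
  fix k
  let ?I = "{k\<^sup>2..<(Suc k)\<^sup>2}"
  show "square_integrable M (\<lambda>x. (\<Sum>n\<in>?I. norm (\<xi> n x)) /\<^sub>R (real k)\<^sup>2)"
    by (intro square_integrable_scaleR square_integrable_sum square_integrable_norm square_integrable)
  have K_nonneg: "0 \<le> K"
    by (rule order_trans[OF Bochner_Integration.integral_nonneg second_moment_le]) simp
  show "(\<integral>x. (norm ((\<Sum>n\<in>?I. norm (\<xi> n x)) /\<^sub>R (real k)\<^sup>2))\<^sup>2 \<partial>M) \<le> 9 * K / (real k)\<^sup>2"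
  proof (cases "k = 0")
    case False
    have "card ?I = 2 * k + 1"
      by (simp add: power2_eq_square)
    then have "(\<integral>x. (\<Sum>n\<in>?I. norm (\<xi> n x))\<^sup>2 \<partial>M) \<le> (real (2 * k + 1))\<^sup>2 * K"
      using second_moment_sum_norm_le[of ?I, OF square_integrable second_moment_le] by (simp only:)
    also have "\<dots> \<le> (3 * real k)\<^sup>2 * K"
      using False K_nonneg by (intro mult_right_mono power_mono) auto
    finally have "(\<integral>x. (\<Sum>n\<in>?I. norm (\<xi> n x))\<^sup>2 \<partial>M) / (real k)^4 \<le> (3 * real k)\<^sup>2 * K / (real k)^4"
      by (rule divide_right_mono) simp
    then show ?thesis
      using False by (simp add: field_simps power2_eq_square power4_eq_xxxx)
  qed simp
qed

text \<open>Chebyshev's inequality controls the averages at the times \<open>k\<^sup>2\<close>, and the Cauchy-Schwarz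
  inequality the fluctuation between \<open>k\<^sup>2\<close> and \<open>(k + 1)\<^sup>2\<close>.\<close>

theorem AE_average_orthogonal_tendsto_0:
  fixes \<xi> :: "nat \<Rightarrow> 'w \<Rightarrow> 'a::euclidean_space"
  assumes "\<And>n. square_integrable M (\<xi> n)"
    and "\<And>n. (\<integral>x. (norm (\<xi> n x))\<^sup>2 \<partial>M) \<le> K"
    and orthogonal: "\<And>m n. m < n \<Longrightarrow> (\<integral>x. inner (\<xi> m x) (\<xi> n x) \<partial>M) = 0"
  shows "AE x in M. (\<lambda>T. (\<Sum>n<T. \<xi> n x) /\<^sub>R real T) \<longlonglongrightarrow> 0"
proof -
  have "(\<integral>x. inner (\<xi> m x) (\<xi> n x) \<partial>M) = 0" if "m \<noteq> n" for m n
    using orthogonal[of m n] orthogonal[of n m] that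
    by (cases m n rule: linorder_cases) (auto simp: inner_commute)
  with assms(1,2) have "AE x in M. (\<lambda>k. (\<Sum>n<k\<^sup>2. \<xi> n x) /\<^sub>R (real k)\<^sup>2) \<longlonglongrightarrow> 0"
    by (rule AE_average_at_squares_tendsto_0)
  with AE_average_over_square_blocks_tendsto_0[OF assms(1,2)] show ?thesis
    by eventually_elim (rule average_tendsto_0_of_squares)
qed

text \<open>Dominated convergence for series: the term with index \<open>n\<close> is bounded by \<open>norm (x n)\<close> since
  \<open>b\<close> is increasing, and tends to \<open>0\<close> since \<open>b\<close> is unbounded.\<close>

lemma Kronecker_lemma_absolute:
  fixes x b :: "nat \<Rightarrow> real"
  assumes x_summable: "summable (\<lambda>n. norm (x n))"
    and b_unbounded: "mono b" "\<And>n. 0 < b n" "filterlim b at_top sequentially"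
  shows "(\<lambda>T. (\<Sum>n\<le>T. b n * x n) / b T) \<longlonglongrightarrow> 0"
proof -
  define f where "f n T = (if n \<le> T then b n * x n / b T else 0)" for n T
  have "(\<lambda>T. \<Sum>n. f n T) \<longlonglongrightarrow> (\<Sum>n::nat. 0)"
  proof (rule tannerys_theorem[THEN conjunct2, THEN conjunct2])
    fix n
    have "(\<lambda>T. b n * x n / b T) \<longlonglongrightarrow> 0"
      using b_unbounded(3) by (rule real_tendsto_divide_at_top[OF tendsto_const])
    then show "(\<lambda>T. f n T) \<longlonglongrightarrow> 0"
      by (rule Lim_transform_eventually) (auto simp: f_def intro: eventually_sequentiallyI[of n])
  next
    have "norm (f n T) \<le> norm (x n)" for n T
      using monoD[OF b_unbounded(1), of n T] b_unbounded(2)[of T] b_unbounded(2)[of n]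
      by (auto simp: f_def abs_mult pos_divide_le_eq mult.commute intro: mult_right_mono)
    then show "\<forall>\<^sub>F (n, T) in sequentially \<times>\<^sub>F sequentially. norm (f n T) \<le> norm (x n)"
      by (intro always_eventually) auto
  qed (use x_summable in simp_all)
  moreover have "(\<Sum>n. f n T) = (\<Sum>n\<le>T. b n * x n) / b T" for T
    by (subst suminf_finite[of "{..T}"]) (auto simp: f_def sum_divide_distrib)
  ultimately show ?thesis
    by simp
qed

subsection \<open>Martingale differences\<close>

lemma (in sigma_finite_subalgebra) integral_mult_eq_0_of_real_cond_exp_eq_0:
  assumes f_measurable: "f \<in> borel_measurable F" and g_measurable: "g \<in> borel_measurable M"
    and integrable: "integrable M (\<lambda>x. f x * g x)"
    and cond_exp_zero: "AE x in M. real_cond_exp M F g x = 0"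
  shows "(\<integral>x. f x * g x \<partial>M) = 0"
proof -
  have "AE x in M. f x * real_cond_exp M F g x = 0"
    using cond_exp_zero by eventually_elim simp
  then have "(\<integral>x. f x * real_cond_exp M F g x \<partial>M) = 0"
    by (rule integral_eq_zero_AE)
  then show ?thesis
    by (simp add: real_cond_exp_intg(2)[OF integrable f_measurable g_measurable])
qed

locale filtered_prob_space = prob_space M + filtration "space M" F
  for M :: "'w measure" and F :: "nat \<Rightarrow> 'w measure" +
  assumes sets_F_subset: "sets (F n) \<subseteq> sets M"
begin

lemma subalgebra_F: "subalgebra M (F n)"
  by (simp add: subalgebra_def space_F sets_F_subset)

lemma measurable_of_F: "f \<in> measurable (F n) N \<Longrightarrow> f \<in> measurable M N"
  by (rule measurable_from_subalg[OF subalgebra_F])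

lemma measurable_F_mono: "f \<in> measurable (F m) N \<Longrightarrow> m \<le> n \<Longrightarrow> f \<in> measurable (F n) N"
  using sets_F_mono[of m n] by (auto simp: measurable_def space_F)

lemma sigma_finite_subalgebra_F: "sigma_finite_subalgebra M (F n)"
  by (intro finite_measure_subalgebra_is_sigma_finite finite_measure_subalgebra.intro
      finite_measure_subalgebra_axioms.intro subalgebra_F finite_measure_axioms)

end

locale martingale_difference = filtered_prob_space M F
  for M :: "'w measure" and F +
  fixes \<xi> :: "nat \<Rightarrow> 'w \<Rightarrow> 'a::euclidean_space" and K :: real
  assumes adapted: "\<xi> n \<in> borel_measurable (F (Suc n))"
    and difference_square_integrable: "square_integrable M (\<xi> n)"
    and second_moment_le: "expectation (\<lambda>\<omega>. (norm (\<xi> n \<omega>))\<^sup>2) \<le> K"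
    and cond_exp_eq_0: "b \<in> Basis \<Longrightarrow> AE \<omega> in M. real_cond_exp M (F n) (\<lambda>\<omega>. inner (\<xi> n \<omega>) b) \<omega> = 0"
begin

lemma expectation_inner_eq_0:
  assumes W_predictable: "W \<in> borel_measurable (F n)" "square_integrable M W"
  shows "expectation (\<lambda>\<omega>. inner (\<xi> n \<omega>) (W \<omega>)) = 0"
proof -
  interpret sigma_finite_subalgebra M "F n"
    by (rule sigma_finite_subalgebra_F)
  have component_integrable: "integrable M (\<lambda>\<omega>. inner (W \<omega>) b * inner (\<xi> n \<omega>) b)" for b
    using integrable_inner_of_square_integrable[OF W_predictable(2)[THEN square_integrable_inner_const]
        difference_square_integrable[THEN square_integrable_inner_const], of b n b] by simp
  have "expectation (\<lambda>\<omega>. inner (W \<omega>) b * inner (\<xi> n \<omega>) b) = 0" if "b \<in> Basis" for b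
    using W_predictable(1) square_integrable_measurable[OF difference_square_integrable] cond_exp_eq_0[OF that]
    by (intro integral_mult_eq_0_of_real_cond_exp_eq_0 component_integrable borel_measurable_inner) simp_all
  moreover have "inner (\<xi> n \<omega>) (W \<omega>) = (\<Sum>b\<in>Basis. inner (W \<omega>) b * inner (\<xi> n \<omega>) b)" for \<omega>
    by (subst euclidean_inner) (simp add: mult.commute)
  ultimately show ?thesis
    by (simp add: Bochner_Integration.integral_sum component_integrable)
qed

lemma measurable_F_less: "m < n \<Longrightarrow> \<xi> m \<in> borel_measurable (F n)"
  using measurable_F_mono[OF adapted] by simp

theorem AE_average_tendsto_0: "AE \<omega> in M. (\<lambda>T. (\<Sum>n<T. \<xi> n \<omega>) /\<^sub>R real T) \<longlonglongrightarrow> 0"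
proof (rule AE_average_orthogonal_tendsto_0[OF difference_square_integrable second_moment_le])
  fix m n :: nat
  assume "m < n"
  then have "expectation (\<lambda>\<omega>. inner (\<xi> n \<omega>) (\<xi> m \<omega>)) = 0"
    by (intro expectation_inner_eq_0 measurable_F_less difference_square_integrable)
  then show "expectation (\<lambda>\<omega>. inner (\<xi> m \<omega>) (\<xi> n \<omega>)) = 0"
    by (simp add: inner_commute)
qed

theorem AE_average_inner_tendsto_0:
  assumes w_measurable: "\<And>n. w n \<in> borel_measurable (F n)"
    and w_le: "\<And>n \<omega>. \<omega> \<in> space M \<Longrightarrow> norm (w n \<omega>) \<le> c"
  shows "AE \<omega> in M. (\<lambda>T. (\<Sum>n<T. inner (\<xi> n \<omega>) (w n \<omega>)) /\<^sub>R real T) \<longlonglongrightarrow> 0"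
proof (rule AE_average_orthogonal_tendsto_0)
  have inner_square_integrable: "square_integrable M (\<lambda>\<omega>. inner (\<xi> n \<omega>) (w n \<omega>))" for n
    by (rule square_integrable_inner_bounded[OF difference_square_integrable
          measurable_of_F[OF w_measurable] w_le])
  then show "square_integrable M (\<lambda>\<omega>. inner (\<xi> n \<omega>) (w n \<omega>))" for n .
  fix n
  have "expectation (\<lambda>\<omega>. (inner (\<xi> n \<omega>) (w n \<omega>))\<^sup>2) \<le> c\<^sup>2 * expectation (\<lambda>\<omega>. (norm (\<xi> n \<omega>))\<^sup>2)"
    by (rule second_moment_inner_bounded_le[OF difference_square_integrable
          measurable_of_F[OF w_measurable] w_le])
  also have "\<dots> \<le> c\<^sup>2 * K"
    by (intro mult_left_mono second_moment_le) simp
  finally show "expectation (\<lambda>\<omega>. (norm (inner (\<xi> n \<omega>) (w n \<omega>)))\<^sup>2) \<le> c\<^sup>2 * K"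
    by simp
  fix m assume "m < n"
  define W where "W \<omega> = inner (\<xi> m \<omega>) (w m \<omega>) *\<^sub>R w n \<omega>" for \<omega>
  have "W \<in> borel_measurable (F n)"
    unfolding W_def
    using measurable_F_less[OF \<open>m < n\<close>] measurable_F_mono[OF w_measurable, of m n] \<open>m < n\<close>
    by (intro borel_measurable_scaleR borel_measurable_inner w_measurable) simp_all
  moreover from this have "square_integrable M W"
    using w_le
    by (intro square_integrable_bound[OF inner_square_integrable[of m], where c = c] measurable_of_F)
      (auto simp: W_def mult.commute[of c] intro: mult_left_mono)
  ultimately have "expectation (\<lambda>\<omega>. inner (\<xi> n \<omega>) (W \<omega>)) = 0"
    by (rule expectation_inner_eq_0)
  then show "expectation (\<lambda>\<omega>. inner (inner (\<xi> m \<omega>) (w m \<omega>)) (inner (\<xi> n \<omega>) (w n \<omega>))) = 0"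
    by (simp add: W_def)
qed

end

section \<open>Online gradient ascent\<close>

lemma gradient_step_le:
  fixes x v z :: "'a::real_inner"
  assumes "0 < g" and step: "norm (x' - z) \<le> norm (x + g *\<^sub>R v - z)"
  shows "inner v (z - x) \<le> ((norm (x - z))\<^sup>2 - (norm (x' - z))\<^sup>2) / (2 * g) + g * (norm v)\<^sup>2 / 2"
proof -
  have "(norm (x' - z))\<^sup>2 \<le> (norm (x - z + g *\<^sub>R v))\<^sup>2"
    using step by (intro power_mono) (simp_all add: algebra_simps)
  also have "\<dots> = (norm (x - z))\<^sup>2 - 2 * g * inner v (z - x) + g\<^sup>2 * (norm v)\<^sup>2"
    unfolding power2_norm_eq_inner by (simp add: algebra_simps inner_commute power2_eq_square)
  finally show ?thesis
    using \<open>0 < g\<close> by (simp add: field_simps power2_eq_square)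
qed

lemma online_gradient_bound:
  fixes x v :: "nat \<Rightarrow> 'a::real_inner"
  assumes step: "\<And>n. norm (x (Suc n) - z) \<le> norm (x n + g n *\<^sub>R v n - z)"
    and dist_le: "\<And>n. norm (x n - z) \<le> D"
    and g_pos: "\<And>n. 0 < g n" and g_antimono: "antimono g"
  shows "(\<Sum>n\<le>T. inner (v n) (z - x n)) \<le> D\<^sup>2 / (2 * g T) + (\<Sum>n\<le>T. g n * (norm (v n))\<^sup>2) / 2"
proof -
  define d where "d n = (norm (x n - z))\<^sup>2" for n
  have d_le: "d n \<le> D\<^sup>2" for n
    using dist_le by (simp add: d_def power_mono)
  have one_step: "inner (v n) (z - x n) \<le> (d n - d (Suc n)) / (2 * g n) + g n * (norm (v n))\<^sup>2 / 2" for n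
    unfolding d_def by (rule gradient_step_le[OF g_pos step])
  have "(\<Sum>n\<le>T. inner (v n) (z - x n)) \<le> (D\<^sup>2 - d (Suc T)) / (2 * g T) + (\<Sum>n\<le>T. g n * (norm (v n))\<^sup>2) / 2"
  proof (induction T)
    case 0
    have "(d 0 - d (Suc 0)) / (2 * g 0) \<le> (D\<^sup>2 - d (Suc 0)) / (2 * g 0)"
      using d_le[of 0] g_pos[of 0] by (intro divide_right_mono) auto
    then show ?case
      using one_step[of 0] by simp
  next
    case (Suc T)
    have "(D\<^sup>2 - d (Suc T)) / (2 * g T) \<le> (D\<^sup>2 - d (Suc T)) / (2 * g (Suc T))"
      using d_le g_pos antimonoD[OF g_antimono, of T "Suc T"] by (intro divide_left_mono) auto
    then have "(D\<^sup>2 - d (Suc T)) / (2 * g T) + (d (Suc T) - d (Suc (Suc T))) / (2 * g (Suc T)) \<le>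
        (D\<^sup>2 - d (Suc (Suc T))) / (2 * g (Suc T))"
      by (simp add: diff_divide_distrib)
    then show ?case
      using Suc.IH one_step[of "Suc T"] by (simp add: add_divide_distrib)
  qed
  moreover have "(D\<^sup>2 - d (Suc T)) / (2 * g T) \<le> D\<^sup>2 / (2 * g T)"
    using g_pos[of T] by (intro divide_right_mono) (auto simp: d_def)
  ultimately show ?thesis
    by simp
qed

definition static_regret :: "'a set \<Rightarrow> (nat \<Rightarrow> 'a \<Rightarrow> real) \<Rightarrow> (nat \<Rightarrow> 'a) \<Rightarrow> nat \<Rightarrow> real" where
  "static_regret C u x T = (SUP y\<in>C. \<Sum>n<T. u n y - u n (x n))"

lemma static_regret_eq:
  assumes "C \<noteq> {}" "bdd_above ((\<lambda>y. \<Sum>n<T. u n y) ` C)"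
  shows "static_regret C u x T = (SUP y\<in>C. \<Sum>n<T. u n y) - (\<Sum>n<T. u n (x n))"
  using Sup_add_eq[OF assms(2,1), of "- (\<Sum>n<T. u n (x n))"]
  by (simp add: static_regret_def sum_subtractf)

lemma static_regret_le:
  assumes "C \<noteq> {}" "\<And>y. y \<in> C \<Longrightarrow> (\<Sum>n<T. u n y) - (\<Sum>n<T. u n (x n)) \<le> c"
  shows "static_regret C u x T \<le> c"
  unfolding static_regret_def using assms by (intro cSUP_least) (auto simp: sum_subtractf)

subsection \<open>Projected ascent along adapted directions\<close>

locale adapted_projected_ascent = filtered_prob_space M F
  for M :: "'w measure" and F +
  fixes C :: "'a::euclidean_space set" and g :: "nat \<Rightarrow> real" and x v :: "nat \<Rightarrow> 'w \<Rightarrow> 'a"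
  assumes compact_domain: "compact C" and convex_domain: "convex C"
    and initial: "\<omega> \<in> space M \<Longrightarrow> x 0 \<omega> \<in> C"
    and initial_measurable: "x 0 \<in> borel_measurable (F 0)"
    and step: "\<omega> \<in> space M \<Longrightarrow> x (Suc n) \<omega> = closest_point C (x n \<omega> + g n *\<^sub>R v n \<omega>)"
    and direction_measurable: "v n \<in> borel_measurable (F (Suc n))"
begin

lemma nonempty: "C \<noteq> {}"
  using initial not_empty by auto

lemma iterate_mem: "\<omega> \<in> space M \<Longrightarrow> x n \<omega> \<in> C"
  using initial nonempty compact_domain
  by (cases n) (simp_all add: step closest_point_in_set compact_imp_closed)

lemma iterate_measurable: "x n \<in> borel_measurable (F n)"
proof (induction n)
  case (Suc n)
  have [measurable]: "x n \<in> borel_measurable (F (Suc n))" "v n \<in> borel_measurable (F (Suc n))"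
    using measurable_F_mono[OF Suc.IH] direction_measurable by simp_all
  have [measurable]: "closest_point C \<in> borel_measurable borel"
    using compact_domain convex_domain nonempty
    by (intro borel_measurable_continuous_onI continuous_on_closest_point compact_imp_closed)
  have "(\<lambda>\<omega>. closest_point C (x n \<omega> + g n *\<^sub>R v n \<omega>)) \<in> borel_measurable (F (Suc n))"
    by measurable
  then show ?case
    by (subst measurable_cong[of _ _ "\<lambda>\<omega>. closest_point C (x n \<omega> + g n *\<^sub>R v n \<omega>)"])
      (simp_all add: space_F step)
qed (rule initial_measurable)

lemma continuous_iterate_measurable:
  fixes f :: "'a \<Rightarrow> 'b::topological_space"
  assumes "continuous_on C f"
  shows "(\<lambda>\<omega>. f (x n \<omega>)) \<in> borel_measurable (F n)"
proof (rule measurable_compose[OF _ borel_measurable_continuous_on_restrict[OF assms]])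
  show "x n \<in> F n \<rightarrow>\<^sub>M restrict_space borel C"
    using iterate_mem iterate_measurable by (intro measurable_restrict_space2) (auto simp: space_F)
qed

lemma domain_bounded:
  obtains c where "\<And>y. y \<in> C \<Longrightarrow> norm y \<le> c"
  using compact_imp_bounded[OF compact_domain] by (auto simp: bounded_iff)

lemma distance_le_diameter: "\<omega> \<in> space M \<Longrightarrow> y \<in> C \<Longrightarrow> norm (x n \<omega> - y) \<le> diameter C"
  using diameter_bounded_bound[OF compact_imp_bounded[OF compact_domain] iterate_mem]
  by (simp add: dist_norm)

lemma step_distance_le:
  assumes "\<omega> \<in> space M" "z \<in> C"
  shows "norm (x (Suc n) \<omega> - z) \<le> norm (x n \<omega> + g n *\<^sub>R v n \<omega> - z)"
  using closest_point_lipschitz[OF convex_domain compact_imp_closed[OF compact_domain] nonempty,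
      of "x n \<omega> + g n *\<^sub>R v n \<omega>" z] assms
  by (simp add: step closest_point_self dist_norm)

end

subsection \<open>Stochastic gradients\<close>

locale stochastic_gradient_ascent = adapted_projected_ascent M F C g x v
  for M :: "'w measure" and F and C :: "'a::euclidean_space set" and g x v +
  fixes u :: "nat \<Rightarrow> 'a \<Rightarrow> real" and V :: "nat \<Rightarrow> 'a \<Rightarrow> 'a" and G K :: real
  assumes step_pos: "0 < g n" and step_antimono: "antimono g"
    and objective_continuous: "continuous_on C (u n)"
    and gradient_continuous: "continuous_on C (V n)"
    and supergradient: "y \<in> C \<Longrightarrow> z \<in> C \<Longrightarrow> u n z - u n y \<le> inner (V n y) (z - y)"
    and gradient_le: "\<omega> \<in> space M \<Longrightarrow> norm (V n (x n \<omega>)) \<le> G"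
    and unbiased: "b \<in> Basis \<Longrightarrow>
      AE \<omega> in M. real_cond_exp M (F n) (\<lambda>\<omega>. inner (v n \<omega>) b) \<omega> = inner (V n (x n \<omega>)) b"
    and error_square_integrable: "square_integrable M (\<lambda>\<omega>. v n \<omega> - V n (x n \<omega>))"
    and error_second_moment_le: "expectation (\<lambda>\<omega>. (norm (v n \<omega> - V n (x n \<omega>)))\<^sup>2) \<le> K"
begin

definition error :: "nat \<Rightarrow> 'w \<Rightarrow> 'a" where
  "error n \<omega> = v n \<omega> - V n (x n \<omega>)"

lemma gradient_measurable: "(\<lambda>\<omega>. V n (x n \<omega>)) \<in> borel_measurable (F n)"
  by (rule continuous_iterate_measurable[OF gradient_continuous])

lemma gradient_square_integrable: "square_integrable M (\<lambda>\<omega>. V n (x n \<omega>))"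
  by (rule square_integrable_const_bound[OF measurable_of_F[OF gradient_measurable] gradient_le])

lemma estimate_square_integrable: "square_integrable M (v n)"
  using square_integrable_add[OF error_square_integrable[of n] gradient_square_integrable[of n]]
  by simp

sublocale martingale_difference M F error K
proof
  fix n
  show "error n \<in> borel_measurable (F (Suc n))"
    unfolding error_def
    using measurable_F_mono[OF gradient_measurable, of n "Suc n"] direction_measurable
    by (intro borel_measurable_diff) simp_all
  show "square_integrable M (error n)" "expectation (\<lambda>\<omega>. (norm (error n \<omega>))\<^sup>2) \<le> K"
    unfolding error_def by (rule error_square_integrable error_second_moment_le)+
  fix b :: 'a assume b_Basis: "b \<in> Basis"
  interpret sigma_finite_subalgebra M "F n"
    by (rule sigma_finite_subalgebra_F)
  have components_integrable: "integrable M (\<lambda>\<omega>. inner (v n \<omega>) b)"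
    "integrable M (\<lambda>\<omega>. inner (V n (x n \<omega>)) b)"
    using estimate_square_integrable gradient_square_integrable
    by (simp_all add: integrable_inner_const_of_square_integrable)
  have "AE \<omega> in M. real_cond_exp M (F n) (\<lambda>\<omega>. inner (V n (x n \<omega>)) b) \<omega> = inner (V n (x n \<omega>)) b"
    using gradient_measurable components_integrable(2) by (intro real_cond_exp_F_meas) simp_all
  with unbiased[OF b_Basis, of n] real_cond_exp_diff[OF components_integrable]
  show "AE \<omega> in M. real_cond_exp M (F n) (\<lambda>\<omega>. inner (error n \<omega>) b) \<omega> = 0"
    unfolding error_def inner_diff_left by eventually_elim simp
qed

lemma estimate_second_moment_le: "expectation (\<lambda>\<omega>. (norm (v n \<omega>))\<^sup>2) \<le> 2 * K + 2 * G\<^sup>2"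
proof -
  have "expectation (\<lambda>\<omega>. (norm (v n \<omega>))\<^sup>2) \<le> expectation (\<lambda>\<omega>. 2 * (norm (error n \<omega>))\<^sup>2 + 2 * G\<^sup>2)"
  proof (rule integral_mono)
    fix \<omega> assume "\<omega> \<in> space M"
    then have "(norm (V n (x n \<omega>)))\<^sup>2 \<le> G\<^sup>2"
      using gradient_le by (simp add: power_mono)
    then show "(norm (v n \<omega>))\<^sup>2 \<le> 2 * (norm (error n \<omega>))\<^sup>2 + 2 * G\<^sup>2"
      using norm_add_power2_le[of "error n \<omega>" "V n (x n \<omega>)"] by (simp add: error_def)
  qed (use difference_square_integrable estimate_square_integrable in \<open>simp_all add: square_integrable_def\<close>)
  also have "\<dots> \<le> 2 * K + 2 * G\<^sup>2"
    using difference_square_integrable[of n] second_moment_le[of n]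
    by (simp add: square_integrable_def prob_space)
  finally show ?thesis .
qed

lemma regret_against_le:
  assumes in_space: "\<omega> \<in> space M" and y_mem: "y \<in> C"
  shows "(\<Sum>n\<le>T. u n y) - (\<Sum>n\<le>T. u n (x n \<omega>)) \<le> (diameter C)\<^sup>2 / (2 * g T)
    + (\<Sum>n\<le>T. g n * (norm (v n \<omega>))\<^sup>2) / 2 - (\<Sum>n\<le>T. inner (error n \<omega>) (y - x n \<omega>))"
proof -
  have "(\<Sum>n\<le>T. u n y) - (\<Sum>n\<le>T. u n (x n \<omega>)) \<le> (\<Sum>n\<le>T. inner (V n (x n \<omega>)) (y - x n \<omega>))"
    unfolding sum_subtractf[symmetric] by (intro sum_mono supergradient iterate_mem in_space y_mem)
  also have "\<dots> = (\<Sum>n\<le>T. inner (v n \<omega>) (y - x n \<omega>)) - (\<Sum>n\<le>T. inner (error n \<omega>) (y - x n \<omega>))"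
    by (simp add: error_def inner_diff_left sum_subtractf)
  also have "(\<Sum>n\<le>T. inner (v n \<omega>) (y - x n \<omega>)) \<le>
      (diameter C)\<^sup>2 / (2 * g T) + (\<Sum>n\<le>T. g n * (norm (v n \<omega>))\<^sup>2) / 2"
    by (intro online_gradient_bound step_distance_le distance_le_diameter step_pos step_antimono
        in_space y_mem)
  finally show ?thesis by simp
qed

lemma AE_weighted_average_tendsto_0:
  assumes "summable (\<lambda>n. g n / real (Suc n))"
  shows "AE \<omega> in M. (\<lambda>T. (\<Sum>n\<le>T. g n * (norm (v n \<omega>))\<^sup>2) / real (Suc T)) \<longlonglongrightarrow> 0"
proof -
  have "AE \<omega> in M. summable (\<lambda>n. g n * (norm (v n \<omega>))\<^sup>2 / real (Suc n))"
  proof (rule AE_summable_of_summable_integral)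
    fix n
    show "integrable M (\<lambda>\<omega>. g n * (norm (v n \<omega>))\<^sup>2 / real (Suc n))"
      using estimate_square_integrable by (simp add: square_integrable_def)
    show "0 \<le> g n * (norm (v n \<omega>))\<^sup>2 / real (Suc n)" for \<omega>
      using step_pos[of n] by simp
    have "expectation (\<lambda>\<omega>. g n * (norm (v n \<omega>))\<^sup>2 / real (Suc n)) =
        g n / real (Suc n) * expectation (\<lambda>\<omega>. (norm (v n \<omega>))\<^sup>2)"
      by simp
    also have "\<dots> \<le> g n / real (Suc n) * (2 * K + 2 * G\<^sup>2)"
      using step_pos[of n] by (intro mult_left_mono estimate_second_moment_le) simp
    finally show "expectation (\<lambda>\<omega>. g n * (norm (v n \<omega>))\<^sup>2 / real (Suc n)) \<le>
        g n / real (Suc n) * (2 * K + 2 * G\<^sup>2)" .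
  qed (intro summable_mult2 assms)
  then show ?thesis
  proof eventually_elim
    fix \<omega> assume "summable (\<lambda>n. g n * (norm (v n \<omega>))\<^sup>2 / real (Suc n))"
    then have "summable (\<lambda>n. norm (g n * (norm (v n \<omega>))\<^sup>2 / real (Suc n)))"
      using step_pos by (simp add: abs_mult less_imp_le)
    from Kronecker_lemma_absolute[OF this, of "\<lambda>n. real (Suc n)"]
    show "(\<lambda>T. (\<Sum>n\<le>T. g n * (norm (v n \<omega>))\<^sup>2) / real (Suc T)) \<longlonglongrightarrow> 0"
      using filterlim_Suc
      by (simp add: mono_def filterlim_compose[OF filterlim_real_sequentially] del: of_nat_Suc)
  qed
qed

lemma static_regret_le_error_sums:
  assumes in_space: "\<omega> \<in> space M" and norm_le: "\<And>y. y \<in> C \<Longrightarrow> norm y \<le> c"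
  shows "static_regret C u (\<lambda>n. x n \<omega>) (Suc T) \<le> (diameter C)\<^sup>2 / (2 * g T)
    + (\<Sum>n\<le>T. g n * (norm (v n \<omega>))\<^sup>2) / 2 + c * norm (\<Sum>n\<le>T. error n \<omega>)
    + (\<Sum>n\<le>T. inner (error n \<omega>) (x n \<omega>))"
proof (rule static_regret_le[OF nonempty])
  fix y assume y_mem: "y \<in> C"
  have "- inner (\<Sum>n\<le>T. error n \<omega>) y \<le> c * norm (\<Sum>n\<le>T. error n \<omega>)"
    using abs_inner_le_of_norm_le[OF norm_le[OF y_mem], of "\<Sum>n\<le>T. error n \<omega>"] by linarith
  then show "(\<Sum>n<Suc T. u n y) - (\<Sum>n<Suc T. u n (x n \<omega>)) \<le> (diameter C)\<^sup>2 / (2 * g T)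
    + (\<Sum>n\<le>T. g n * (norm (v n \<omega>))\<^sup>2) / 2 + c * norm (\<Sum>n\<le>T. error n \<omega>)
    + (\<Sum>n\<le>T. inner (error n \<omega>) (x n \<omega>))"
    using regret_against_le[OF in_space y_mem, of T]
    by (simp add: lessThan_Suc_atMost inner_diff_right sum_subtractf inner_sum_left)
qed

lemma limsup_average_regret_le_0:
  assumes in_space: "\<omega> \<in> space M"
    and slow_steps: "(\<lambda>n. 1 / (g n * real (Suc n))) \<longlonglongrightarrow> 0"
    and square_average: "(\<lambda>T. (\<Sum>n\<le>T. g n * (norm (v n \<omega>))\<^sup>2) / real (Suc T)) \<longlonglongrightarrow> 0"
    and error_average: "(\<lambda>T. (\<Sum>n<T. error n \<omega>) /\<^sub>R real T) \<longlonglongrightarrow> 0"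
    and error_inner_average: "(\<lambda>T. (\<Sum>n<T. inner (error n \<omega>) (x n \<omega>)) /\<^sub>R real T) \<longlonglongrightarrow> 0"
  shows "limsup (\<lambda>T. ereal (static_regret C u (\<lambda>n. x n \<omega>) T / real T)) \<le> 0"
proof -
  obtain c where norm_le: "\<And>y. y \<in> C \<Longrightarrow> norm y \<le> c"
    using domain_bounded by blast
  define b where "b T = ((diameter C)\<^sup>2 / (2 * g T) + (\<Sum>n\<le>T. g n * (norm (v n \<omega>))\<^sup>2) / 2
    + c * norm (\<Sum>n\<le>T. error n \<omega>) + (\<Sum>n\<le>T. inner (error n \<omega>) (x n \<omega>))) / real (Suc T)" for T
  have "(\<lambda>T. (diameter C)\<^sup>2 / (2 * g T) / real (Suc T)) \<longlonglongrightarrow> 0"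
    using tendsto_mult_right_zero[OF slow_steps, of "(diameter C)\<^sup>2 / 2"]
    by (simp add: mult.assoc del: of_nat_Suc)
  moreover have "(\<lambda>T. (\<Sum>n\<le>T. g n * (norm (v n \<omega>))\<^sup>2) / 2 / real (Suc T)) \<longlonglongrightarrow> 0"
    using tendsto_divide_zero[OF square_average, of 2] by (simp add: mult.commute del: of_nat_Suc)
  moreover have "(\<lambda>T. c * norm (\<Sum>n\<le>T. error n \<omega>) / real (Suc T)) \<longlonglongrightarrow> 0"
    using tendsto_mult_right_zero[OF tendsto_norm_zero[OF LIMSEQ_Suc[OF error_average]], of c]
    by (simp add: lessThan_Suc_atMost divide_inverse_commute mult.left_commute del: of_nat_Suc)
  moreover have "(\<lambda>T. (\<Sum>n\<le>T. inner (error n \<omega>) (x n \<omega>)) / real (Suc T)) \<longlonglongrightarrow> 0"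
    using LIMSEQ_Suc[OF error_inner_average]
    by (simp add: lessThan_Suc_atMost divide_inverse_commute del: of_nat_Suc)
  ultimately have "b \<longlonglongrightarrow> 0 + 0 + 0 + 0"
    unfolding b_def add_divide_distrib by (intro tendsto_add)
  then have b_tendsto_0: "(\<lambda>T. ereal (b T)) \<longlonglongrightarrow> 0"
    by (simp add: zero_ereal_def)
  have "limsup (\<lambda>T. ereal (static_regret C u (\<lambda>n. x n \<omega>) T / real T)) =
      limsup (\<lambda>T. ereal (static_regret C u (\<lambda>n. x n \<omega>) (Suc T) / real (Suc T)))"
    using limsup_shift[of "\<lambda>T. ereal (static_regret C u (\<lambda>n. x n \<omega>) T / real T)"] by simp
  also have "\<dots> \<le> limsup (\<lambda>T. ereal (b T))"
    using static_regret_le_error_sums[OF in_space norm_le]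
    by (intro Limsup_mono always_eventually) (simp add: b_def divide_right_mono del: of_nat_Suc)
  also have "\<dots> = 0"
    using b_tendsto_0 by (intro lim_imp_Limsup) auto
  finally show ?thesis .
qed

theorem AE_no_regret:
  assumes "summable (\<lambda>n. g n / real (Suc n))" and "(\<lambda>n. 1 / (g n * real (Suc n))) \<longlonglongrightarrow> 0"
  shows "AE \<omega> in M. limsup (\<lambda>T. ereal (static_regret C u (\<lambda>n. x n \<omega>) T / real T)) \<le> 0"
proof -
  obtain c where "\<And>y. y \<in> C \<Longrightarrow> norm y \<le> c"
    using domain_bounded by blast
  then have "AE \<omega> in M. (\<lambda>T. (\<Sum>n<T. inner (error n \<omega>) (x n \<omega>)) /\<^sub>R real T) \<longlonglongrightarrow> 0"
    using iterate_mem by (intro AE_average_inner_tendsto_0[OF iterate_measurable, of c]) auto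
  with AE_space AE_weighted_average_tendsto_0[OF assms(1)] AE_average_tendsto_0 show ?thesis
    by eventually_elim (intro limsup_average_regret_le_0 assms(2))
qed

lemma objective_integrable: "integrable M (\<lambda>\<omega>. u n (x n \<omega>))"
proof -
  obtain b where "\<And>y. y \<in> C \<Longrightarrow> norm (u n y) \<le> b"
    using compact_imp_bounded[OF compact_continuous_image[OF objective_continuous compact_domain]]
    unfolding bounded_iff by blast
  then show ?thesis
    using iterate_mem measurable_of_F[OF continuous_iterate_measurable[OF objective_continuous]]
    by (intro integrable_const_bound[of _ b]) auto
qed

lemma static_regret_iterates_eq:
  "static_regret C u (\<lambda>n. x n \<omega>) T = (SUP y\<in>C. \<Sum>n<T. u n y) - (\<Sum>n<T. u n (x n \<omega>))"
  by (intro static_regret_eq nonempty bounded_imp_bdd_above compact_imp_bounded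
      compact_continuous_image continuous_on_sum objective_continuous compact_domain)

lemma static_regret_integrable: "integrable M (\<lambda>\<omega>. static_regret C u (\<lambda>n. x n \<omega>) T)"
  unfolding static_regret_iterates_eq
  by (intro Bochner_Integration.integrable_diff Bochner_Integration.integrable_sum
      objective_integrable) simp

lemma expectation_error_inner:
  assumes "y \<in> C"
  shows "integrable M (\<lambda>\<omega>. inner (error n \<omega>) (y - x n \<omega>))"
    and "expectation (\<lambda>\<omega>. inner (error n \<omega>) (y - x n \<omega>)) = 0"
proof -
  have deviation_measurable: "(\<lambda>\<omega>. y - x n \<omega>) \<in> borel_measurable (F n)"
    using iterate_measurable by (intro borel_measurable_diff) simp_all
  have "norm (y - x n \<omega>) \<le> diameter C" if "\<omega> \<in> space M" for \<omega>
    using distance_le_diameter[OF that assms] by (simp add: norm_minus_commute)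
  then have deviation_square_integrable: "square_integrable M (\<lambda>\<omega>. y - x n \<omega>)"
    by (rule square_integrable_const_bound[OF measurable_of_F[OF deviation_measurable]])
  show "integrable M (\<lambda>\<omega>. inner (error n \<omega>) (y - x n \<omega>))"
    by (rule integrable_inner_of_square_integrable[OF difference_square_integrable
          deviation_square_integrable])
  show "expectation (\<lambda>\<omega>. inner (error n \<omega>) (y - x n \<omega>)) = 0"
    by (rule expectation_inner_eq_0[OF deviation_measurable deviation_square_integrable])
qed

lemma expected_regret_against_le:
  assumes y_mem: "y \<in> C"
  shows "(\<Sum>n\<le>T. u n y) - expectation (\<lambda>\<omega>. \<Sum>n\<le>T. u n (x n \<omega>)) \<le>
    (diameter C)\<^sup>2 / (2 * g T) + (\<Sum>n\<le>T. g n * expectation (\<lambda>\<omega>. (norm (v n \<omega>))\<^sup>2)) / 2"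
proof -
  let ?linear = "\<lambda>\<omega>. \<Sum>n\<le>T. inner (error n \<omega>) (y - x n \<omega>)"
  let ?square = "\<lambda>\<omega>. \<Sum>n\<le>T. g n * (norm (v n \<omega>))\<^sup>2"
  have sums_integrable: "integrable M (\<lambda>\<omega>. \<Sum>n\<le>T. u n (x n \<omega>))"
    "integrable M ?square" "integrable M ?linear"
    using estimate_square_integrable objective_integrable expectation_error_inner(1)[OF y_mem]
    by (auto simp: square_integrable_def)
  have "(\<Sum>n\<le>T. u n y) - expectation (\<lambda>\<omega>. \<Sum>n\<le>T. u n (x n \<omega>)) =
      expectation (\<lambda>\<omega>. (\<Sum>n\<le>T. u n y) - (\<Sum>n\<le>T. u n (x n \<omega>)))"
    using sums_integrable by (simp add: prob_space)
  also have "\<dots> \<le> expectation (\<lambda>\<omega>. (diameter C)\<^sup>2 / (2 * g T) + ?square \<omega> / 2 - ?linear \<omega>)"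
    using sums_integrable by (intro integral_mono regret_against_le y_mem) auto
  also have "\<dots> = (diameter C)\<^sup>2 / (2 * g T) + expectation ?square / 2 - expectation ?linear"
    using sums_integrable by (simp add: prob_space)
  also have "expectation ?linear = 0"
    by (simp add: Bochner_Integration.integral_sum expectation_error_inner[OF y_mem])
  also have "expectation ?square = (\<Sum>n\<le>T. g n * expectation (\<lambda>\<omega>. (norm (v n \<omega>))\<^sup>2))"
    using estimate_square_integrable
    by (simp add: Bochner_Integration.integral_sum square_integrable_def)
  finally show ?thesis by simp
qed

theorem expected_regret_le:
  "expectation (\<lambda>\<omega>. static_regret C u (\<lambda>n. x n \<omega>) (Suc T)) \<le>
    (diameter C)\<^sup>2 / (2 * g T) + (\<Sum>n\<le>T. g n * expectation (\<lambda>\<omega>. (norm (v n \<omega>))\<^sup>2)) / 2"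
proof -
  have objective_sum_integrable: "integrable M (\<lambda>\<omega>. \<Sum>n\<le>T. u n (x n \<omega>))"
    using objective_integrable by simp
  have "(SUP y\<in>C. \<Sum>n\<le>T. u n y) \<le> (diameter C)\<^sup>2 / (2 * g T)
      + (\<Sum>n\<le>T. g n * expectation (\<lambda>\<omega>. (norm (v n \<omega>))\<^sup>2)) / 2 + expectation (\<lambda>\<omega>. \<Sum>n\<le>T. u n (x n \<omega>))"
    using expected_regret_against_le[of _ T] by (intro cSUP_least nonempty) (simp add: diff_le_eq)
  with objective_sum_integrable show ?thesis
    by (simp add: static_regret_iterates_eq lessThan_Suc_atMost prob_space)
qed

corollary expected_regret_le_SUP:
  assumes "(diameter C)\<^sup>2 \<le> D"
  shows "expectation (\<lambda>\<omega>. static_regret C u (\<lambda>n. x n \<omega>) (Suc T)) \<le>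
    D / (2 * g T) + (SUP n. expectation (\<lambda>\<omega>. (norm (v n \<omega>))\<^sup>2)) / 2 * (\<Sum>n\<le>T. g n)"
proof -
  let ?S = "SUP n. expectation (\<lambda>\<omega>. (norm (v n \<omega>))\<^sup>2)"
  have "expectation (\<lambda>\<omega>. (norm (v n \<omega>))\<^sup>2) \<le> ?S" for n
    using estimate_second_moment_le by (intro cSUP_upper bdd_aboveI2) auto
  then have "(\<Sum>n\<le>T. g n * expectation (\<lambda>\<omega>. (norm (v n \<omega>))\<^sup>2)) \<le> (\<Sum>n\<le>T. g n * ?S)"
    using step_pos by (intro sum_mono mult_left_mono) (auto simp: less_imp_le)
  also have "\<dots> = ?S * (\<Sum>n\<le>T. g n)"
    by (simp add: mult.commute flip: sum_distrib_right)
  finally have "(\<Sum>n\<le>T. g n * expectation (\<lambda>\<omega>. (norm (v n \<omega>))\<^sup>2)) \<le> ?S * (\<Sum>n\<le>T. g n)" .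
  moreover have "(diameter C)\<^sup>2 / (2 * g T) \<le> D / (2 * g T)"
    using assms step_pos[of T] by (intro divide_right_mono) auto
  ultimately show ?thesis
    using expected_regret_le[of T] by linarith
qed

end

section \<open>Energy efficiency\<close>

lemma det_mat_1_plus_psd_nonzero:
  fixes A :: "complex^'n^'n"
  assumes "psd A"
  shows "det (mat 1 + A) \<noteq> 0"
proof
  assume "det (mat 1 + A) = 0"
  then obtain x where x_kernel: "x \<noteq> 0" "(mat 1 + A) *v x = 0"
    using invertible_det_nz[of "mat 1 + A"]
    by (metis invertible_left_inverse matrix_left_invertible_ker)
  have "0 = Re (cinner x ((mat 1 + A) *v x))"
    by (simp add: x_kernel cinner_def)
  also have "\<dots> = (norm x)\<^sup>2 + Re (cinner x (A *v x))"
    by (simp add: matrix_vector_mult_add_rdistrib cinner_add_right Re_cinner_self)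
  also have "\<dots> > 0"
    using x_kernel(1) psd_cinner_nonneg[OF assms] by (intro add_pos_nonneg) auto
  finally show False by simp
qed

lemma rate_matrix:
  assumes "psd Q"
  shows psd_rate_matrix: "psd (mat 1 + H ** Q ** adjc H)"
    and det_rate_matrix_nonzero: "det (mat 1 + H ** Q ** adjc H) \<noteq> 0"
  using assms by (auto intro!: psd_add psd_mat_1 psd_congruence det_mat_1_plus_psd_nonzero)

definition rate_grad :: "complex^('k::finite \<times> 'm::finite)^('k \<times> 'n::finite)
    \<Rightarrow> complex^('k \<times> 'm)^('k \<times> 'm) \<Rightarrow> complex^('k \<times> 'm)^('k \<times> 'm)" where
  "rate_grad H Q = adjc H ** matrix_inv (mat 1 + H ** Q ** adjc H) ** H"

lemma rate_tangent:
  assumes "psd Q" "psd Q'"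
  shows "rate H Q' \<le> rate H Q + inner (rate_grad H Q) (Q' - Q)"
proof -
  define P P' where "P = mat 1 + H ** Q ** adjc H" and "P' = mat 1 + H ** Q' ** adjc H"
  have "rate H Q' \<le> rate H Q + inner (matrix_inv P) (P' - P)"
    unfolding rate_def P_def P'_def by (intro ln_det_tangent rate_matrix assms)
  also have "P' - P = H ** (Q' - Q) ** adjc H"
    by (simp add: P_def P'_def matrix_mult_diff_right matrix_mult_diff_left)
  also have "inner (matrix_inv P) (H ** (Q' - Q) ** adjc H) = inner (rate_grad H Q) (Q' - Q)"
    by (simp add: inner_congruence rate_grad_def P_def)
  finally show ?thesis .
qed

subsection \<open>The feasible set\<close>

lemma XSet_psd: "X \<in> XSet \<Longrightarrow> psd X"
  by (simp add: XSet_def)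

lemma XSet_trace_le: "X \<in> XSet \<Longrightarrow> Re (trace X) \<le> 1"
  by (simp add: XSet_def)

lemma XSet_norm_le: "X \<in> XSet \<Longrightarrow> norm X \<le> 1"
  using norm_psd_le_trace[OF XSet_psd, of X] XSet_trace_le[of X] by simp

lemma compact_XSet: "compact XSet"
proof -
  have "closed XSet"
    unfolding XSet_def block_diag_def psd_def hermitian_def trace_def vec_eq_iff adjc_nth
    by (intro closed_Collect_conj closed_Collect_all closed_Collect_imp open_Collect_const
        closed_Collect_le closed_Collect_eq continuous_intros)
  then show ?thesis
    using XSet_norm_le by (auto simp: compact_eq_bounded_closed bounded_iff)
qed

lemma diameter_XSet_power2_le:
  "(diameter (XSet :: (complex^('k::finite \<times> 'm::finite)^('k \<times> 'm)) set))\<^sup>2 \<le> 2"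
proof -
  have "diameter (XSet :: (complex^('k \<times> 'm)^('k \<times> 'm)) set) \<le> sqrt 2"
  proof (rule diameter_le)
    fix X Y :: "complex^('k \<times> 'm)^('k \<times> 'm)"
    assume X_Y_mem: "X \<in> XSet" "Y \<in> XSet"
    have "(norm (X - Y))\<^sup>2 = (norm X)\<^sup>2 + (norm Y)\<^sup>2 - 2 * inner X Y"
      by (simp add: power2_norm_eq_inner inner_commute algebra_simps)
    also have "\<dots> \<le> 1 + 1 - 2 * 0"
      using X_Y_mem by (intro diff_mono add_mono mult_left_mono inner_psd_nonneg XSet_psd)
        (simp_all add: XSet_norm_le power_le_one)
    finally show "norm (X - Y) \<le> sqrt 2"
      by (simp add: real_le_rsqrt)
  qed simp
  then show ?thesis
    using power_mono[of "diameter XSet" "sqrt 2" 2]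
      diameter_ge_0[OF compact_imp_bounded[OF compact_XSet]] by simp
qed

lemma convex_XSet: "convex XSet"
proof (rule convexI)
  fix x y :: "complex^('a \<times> 'b)^('a \<times> 'b)" and u v :: real
  assume x_y_mem: "x \<in> XSet" "y \<in> XSet" and convex_weights: "0 \<le> u" "0 \<le> v" "u + v = 1"
  have "u * Re (trace x) + v * Re (trace y) \<le> u * 1 + v * 1"
    using x_y_mem convex_weights XSet_trace_le by (intro add_mono mult_left_mono) auto
  then show "u *\<^sub>R x + v *\<^sub>R y \<in> XSet"
    using x_y_mem convex_weights
    by (auto simp: XSet_def block_diag_def trace_add trace_scaleR intro!: psd_add psd_scaleR)
qed

lemma proj_eq_closest_point: "proj = closest_point XSet"
  by (simp add: fun_eq_iff proj_def closest_point_def dist_norm norm_minus_commute)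

subsection \<open>The power allocation map\<close>

lemma perspective_tangent:
  fixes a q q' :: "'a::real_inner"
  assumes "f q' \<le> f q + inner a (q' - q)" "0 \<le> s'"
  shows "s' * f q' - s * f q \<le> inner a (s' *\<^sub>R q' - s *\<^sub>R q) - (s' - s) * (inner a q - f q)"
proof -
  have "s' * f q' \<le> s' * (f q + inner a (q' - q))"
    using assms by (rule mult_left_mono)
  then show ?thesis
    by (simp add: inner_diff_right algebra_simps)
qed

text \<open>The energy efficiency at \<open>X\<close> is, up to a constant factor, \<open>s R(X / s)\<close> with \<open>s\<close> the
  following scale and \<open>R\<close> the rate.\<close>

definition power_scale :: "real \<Rightarrow> real \<Rightarrow> complex^'n^'n \<Rightarrow> real" where
  "power_scale Pc Pmax X = (Pc + Pmax * (1 - Re (trace X))) / (Pc * Pmax)"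

lemma Qmap_eq_power_scale: "Qmap Pc Pmax X = (1 / power_scale Pc Pmax X) *\<^sub>R X"
  by (simp add: Qmap_def power_scale_def)

locale power_budget =
  fixes Pc Pmax :: real
  assumes Pc_pos: "0 < Pc" and Pmax_pos: "0 < Pmax"
begin

lemma power_scale_diff:
  "power_scale Pc Pmax Y - power_scale Pc Pmax X = - inner (mat 1) (Y - X) / Pc"
  using Pc_pos Pmax_pos by (simp add: power_scale_def inner_mat_1 trace_sub field_simps)

lemma power_scale_pos:
  assumes "X \<in> XSet"
  shows "0 < power_scale Pc Pmax X"
  using XSet_trace_le[OF assms] Pc_pos Pmax_pos
  by (simp add: power_scale_def add_pos_nonneg)

lemma power_scale_Qmap: "X \<in> XSet \<Longrightarrow> power_scale Pc Pmax X *\<^sub>R Qmap Pc Pmax X = X"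
  using power_scale_pos[of X] by (simp add: Qmap_eq_power_scale)

lemma psd_Qmap: "X \<in> XSet \<Longrightarrow> psd (Qmap Pc Pmax X)"
  using power_scale_pos[of X] XSet_psd[of X] by (simp add: Qmap_eq_power_scale psd_scaleR)

lemma total_power_Qmap:
  assumes "X \<in> XSet"
  shows "Pc + Re (trace (Qmap Pc Pmax X)) = (Pc + Pmax) / (Pmax * power_scale Pc Pmax X)"
proof -
  have "Pc * power_scale Pc Pmax X + Re (trace X) = (Pc + Pmax) / Pmax"
    using Pc_pos Pmax_pos by (simp add: power_scale_def field_simps)
  then have "(Pc * power_scale Pc Pmax X + Re (trace X)) / power_scale Pc Pmax X =
      (Pc + Pmax) / Pmax / power_scale Pc Pmax X"
    by simp
  then show ?thesis
    using power_scale_pos[OF assms]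
    by (simp add: Qmap_eq_power_scale trace_scaleR add_divide_distrib)
qed

lemma Qmap_mem_QSet:
  assumes X_mem: "X \<in> XSet"
  shows "Qmap Pc Pmax X \<in> QSet Pmax"
proof -
  have "1 \<le> Pmax * power_scale Pc Pmax X"
    using XSet_trace_le[OF X_mem] Pc_pos Pmax_pos by (simp add: power_scale_def field_simps)
  then have "(Pc + Pmax) / (Pmax * power_scale Pc Pmax X) \<le> (Pc + Pmax) / 1"
    using Pc_pos Pmax_pos by (intro divide_left_mono) auto
  then have "Re (trace (Qmap Pc Pmax X)) \<le> Pmax"
    using total_power_Qmap[OF X_mem] by simp
  then show ?thesis
    using psd_Qmap[OF X_mem] X_mem by (simp add: QSet_def XSet_def block_diag_def Qmap_def)
qed

lemma Qmap_preimage: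
  assumes Q_mem: "Q \<in> QSet Pmax"
  obtains X where "X \<in> XSet" "Qmap Pc Pmax X = Q"
proof -
  define q where "q = Re (trace Q)"
  define c where "c = (Pc + Pmax) / (Pmax * (Pc + q))"
  have q_bounds: "0 \<le> q" "q \<le> Pmax" "0 < Pc + q"
    using Q_mem Pc_pos by (simp_all add: QSet_def q_def psd_trace_nonneg add_pos_nonneg)
  have "(Pc + Pmax) * q \<le> Pmax * (Pc + q)"
    using q_bounds Pc_pos by (simp add: algebra_simps)
  then have c_bounds: "0 < c" "c * q \<le> 1"
    using q_bounds Pc_pos Pmax_pos by (simp_all add: c_def divide_le_eq)
  have "Pc + Pmax * (1 - c * q) = Pc * Pmax * c"
    using q_bounds Pmax_pos by (simp add: c_def divide_simps) (simp add: algebra_simps)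
  then have "power_scale Pc Pmax (c *\<^sub>R Q) = c"
    using Pc_pos Pmax_pos by (simp add: power_scale_def trace_scaleR flip: q_def)
  then have "Qmap Pc Pmax (c *\<^sub>R Q) = Q"
    using c_bounds by (simp add: Qmap_eq_power_scale)
  moreover have "c *\<^sub>R Q \<in> XSet"
    using Q_mem c_bounds
    by (auto simp: QSet_def XSet_def psd_scaleR block_diag_def trace_scaleR q_def)
  ultimately show ?thesis
    using that by blast
qed

lemma Qmap_image_XSet: "Qmap Pc Pmax ` XSet = QSet Pmax"
  using Qmap_mem_QSet by (auto elim: Qmap_preimage)

lemma EE_Qmap:
  assumes "X \<in> XSet"
  shows "EE Pc H (Qmap Pc Pmax X) =
    Pmax / (Pc + Pmax) * (power_scale Pc Pmax X * rate H (Qmap Pc Pmax X))"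
  by (simp add: EE_def total_power_Qmap[OF assms])

lemma regret_eq_static_regret:
  "regret Pc Pmax H (\<lambda>n. Qmap Pc Pmax (x n)) T =
    static_regret XSet (\<lambda>n X. EE Pc (H (Suc n)) (Qmap Pc Pmax X)) (\<lambda>n. x (Suc n)) T"
  by (simp add: regret_def static_regret_def image_image sum.atLeast1_atMost_eq flip: Qmap_image_XSet)

lemma gradV_eq:
  assumes "X \<in> XSet"
  defines "Q \<equiv> Qmap Pc Pmax X"
  shows "gradV Pc Pmax H X = (Pmax / (Pc + Pmax)) *\<^sub>R
    (rate_grad H Q + ((inner (rate_grad H Q) Q - rate H Q) / Pc) *\<^sub>R mat 1)"
proof -
  have "adjc Q = Q"
    using psd_hermitian[OF psd_Qmap[OF assms(1)]] by (simp add: Q_def hermitian_def)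
  then show ?thesis
    by (simp add: gradV_def Let_def rate_grad_def inner_eq_Re_trace flip: Q_def)
qed

lemma EE_Qmap_tangent:
  assumes X_mem: "X \<in> XSet" and Y_mem: "Y \<in> XSet"
  shows "EE Pc H (Qmap Pc Pmax Y) - EE Pc H (Qmap Pc Pmax X) \<le> inner (gradV Pc Pmax H X) (Y - X)"
proof -
  let ?Q = "Qmap Pc Pmax" and ?s = "power_scale Pc Pmax"
  let ?A = "rate_grad H (?Q X)"
  have "?s Y * rate H (?Q Y) - ?s X * rate H (?Q X) \<le>
      inner ?A (?s Y *\<^sub>R ?Q Y - ?s X *\<^sub>R ?Q X) - (?s Y - ?s X) * (inner ?A (?Q X) - rate H (?Q X))"
    using power_scale_pos[OF Y_mem]
    by (intro perspective_tangent rate_tangent psd_Qmap X_mem Y_mem) simp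
  also have "\<dots> = inner (?A + ((inner ?A (?Q X) - rate H (?Q X)) / Pc) *\<^sub>R mat 1) (Y - X)"
    by (simp add: power_scale_Qmap X_mem Y_mem power_scale_diff inner_add_left mult.commute)
  finally have "Pmax / (Pc + Pmax) * (?s Y * rate H (?Q Y) - ?s X * rate H (?Q X)) \<le>
      Pmax / (Pc + Pmax) * inner (?A + ((inner ?A (?Q X) - rate H (?Q X)) / Pc) *\<^sub>R mat 1) (Y - X)"
    using Pc_pos Pmax_pos by (intro mult_left_mono) auto
  then show ?thesis
    by (simp add: gradV_eq EE_Qmap X_mem Y_mem right_diff_distrib)
qed

lemma continuous_on_Qmap: "continuous_on XSet (Qmap Pc Pmax)"
  unfolding Qmap_def
proof (intro continuous_intros continuous_on_trace ballI)
  fix X assume "X \<in> XSet"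
  from power_scale_pos[OF this] show "Pc + Pmax * (1 - Re (trace X)) \<noteq> 0"
    by (auto simp: power_scale_def)
qed

lemma continuous_on_rate_matrix_Qmap:
  fixes H :: "complex^('k::finite \<times> 'm::finite)^('k \<times> 'n::finite)"
  shows "continuous_on XSet (\<lambda>X. mat 1 + H ** Qmap Pc Pmax X ** adjc H)"
  by (intro continuous_intros continuous_on_matrix_mult continuous_on_Qmap)

lemma continuous_on_rate_Qmap:
  fixes H :: "complex^('k::finite \<times> 'm::finite)^('k \<times> 'n::finite)"
  shows "continuous_on XSet (\<lambda>X. rate H (Qmap Pc Pmax X))"
  unfolding rate_def
proof (intro continuous_on_ln continuous_on_Re continuous_on_det continuous_on_rate_matrix_Qmap ballI)
  fix X :: "complex^('k \<times> 'm)^('k \<times> 'm)"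
  assume "X \<in> XSet"
  then have "0 < Re (det (mat 1 + H ** Qmap Pc Pmax X ** adjc H))"
    by (intro psd_det_pos rate_matrix psd_Qmap)
  then show "Re (det (mat 1 + H ** Qmap Pc Pmax X ** adjc H)) \<noteq> 0"
    by simp
qed

lemma continuous_on_EE_Qmap: "continuous_on XSet (\<lambda>X. EE Pc H (Qmap Pc Pmax X))"
proof (rule continuous_on_eq)
  show "continuous_on XSet (\<lambda>X. Pmax / (Pc + Pmax) * (power_scale Pc Pmax X * rate H (Qmap Pc Pmax X)))"
    unfolding power_scale_def using Pc_pos Pmax_pos
    by (intro continuous_intros continuous_on_trace continuous_on_rate_Qmap) auto
qed (simp add: EE_Qmap)

lemma continuous_on_gradV: "continuous_on XSet (gradV Pc Pmax H)"
proof (rule continuous_on_eq)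
  have rate_grad: "continuous_on XSet (\<lambda>X. rate_grad H (Qmap Pc Pmax X))"
    unfolding rate_grad_def
    by (intro continuous_intros continuous_on_matrix_mult continuous_on_matrix_inv
        continuous_on_rate_matrix_Qmap det_rate_matrix_nonzero psd_Qmap)
  show "continuous_on XSet (\<lambda>X. (Pmax / (Pc + Pmax)) *\<^sub>R (rate_grad H (Qmap Pc Pmax X) +
      ((inner (rate_grad H (Qmap Pc Pmax X)) (Qmap Pc Pmax X) - rate H (Qmap Pc Pmax X)) / Pc) *\<^sub>R mat 1))"
    using Pc_pos
    by (intro continuous_intros rate_grad continuous_on_Qmap continuous_on_rate_Qmap) auto
qed (simp add: gradV_eq)

end

section \<open>Regret of noisy power control\<close>

lemma AE_real_cond_exp_inner_Basis:
  fixes f h :: "'w \<Rightarrow> complex^'n^'m"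
  assumes "\<And>i j. AE x in M. real_cond_exp M F (\<lambda>x. Re (f x $ i $ j)) x = Re (h x $ i $ j)"
    and "\<And>i j. AE x in M. real_cond_exp M F (\<lambda>x. Im (f x $ i $ j)) x = Im (h x $ i $ j)"
    and "b \<in> Basis"
  shows "AE x in M. real_cond_exp M F (\<lambda>x. inner (f x) b) x = inner (h x) b"
  using assms(3) by (cases rule: Basis_complex_matrix_cases) (simp_all add: assms(1,2))

lemma antimono_polynomial_step:
  fixes \<alpha> \<gamma> :: real
  assumes "0 < \<alpha>" "0 < \<gamma>"
  shows "antimono (\<lambda>n. \<gamma> / real (Suc n) powr \<alpha>)"
  using assms by (intro antimonoI divide_left_mono powr_mono2) simp_all

lemma summable_polynomial_step:
  fixes \<alpha> \<gamma> :: real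
  assumes "0 < \<alpha>"
  shows "summable (\<lambda>n. \<gamma> / real (Suc n) powr \<alpha> / real (Suc n))"
proof -
  have "summable (\<lambda>n. real n powr (- 1 - \<alpha>))"
    using assms by (simp add: summable_real_powr_iff)
  then have "summable (\<lambda>n. \<gamma> * real (Suc n) powr (- 1 - \<alpha>))"
    by (intro summable_mult) (simp only: summable_Suc_iff[of "\<lambda>n. real n powr (- 1 - \<alpha>)"])
  then show ?thesis
    by (simp add: powr_diff powr_minus field_simps)
qed

lemma inverse_polynomial_step_average_tendsto_0:
  fixes \<alpha> \<gamma> :: real
  assumes "0 < \<gamma>" "\<alpha> < 1"
  shows "(\<lambda>n. 1 / (\<gamma> / real (Suc n) powr \<alpha> * real (Suc n))) \<longlonglongrightarrow> 0"
  using assms by real_asymp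

locale noisy_power_control = power_budget Pc Pmax + filtered_prob_space M F
  for Pc Pmax :: real and M :: "'w measure" and F +
  fixes H :: "nat \<Rightarrow> complex^('k::finite \<times> 'm::finite)^('k \<times> 'n::finite)"
    and X Vh :: "nat \<Rightarrow> 'w \<Rightarrow> complex^('k \<times> 'm)^('k \<times> 'm)"
    and \<gamma> \<alpha> B \<beta> V0 :: real
  assumes initial: "\<omega> \<in> space M \<Longrightarrow> X 0 \<omega> \<in> XSet"
    and initial_measurable: "X 0 \<in> borel_measurable (F 0)"
    and step: "\<omega> \<in> space M \<Longrightarrow> X (Suc n) \<omega> = proj (X n \<omega> + (\<gamma> / real (Suc n) powr \<alpha>) *\<^sub>R Vh n \<omega>)"
    and step_size: "0 < \<gamma>" "0 < \<alpha>"
    and estimate_measurable: "Vh n \<in> borel_measurable (F (Suc n))"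
    and gradient_le: "\<omega> \<in> space M \<Longrightarrow> norm (gradV Pc Pmax (H n) (X n \<omega>)) \<le> V0"
    and unbiased_Re: "AE \<omega> in M. real_cond_exp M (F n) (\<lambda>\<omega>. Re (Vh n \<omega> $ i $ j)) \<omega>
      = Re (gradV Pc Pmax (H n) (X n \<omega>) $ i $ j)"
    and unbiased_Im: "AE \<omega> in M. real_cond_exp M (F n) (\<lambda>\<omega>. Im (Vh n \<omega> $ i $ j)) \<omega>
      = Im (gradV Pc Pmax (H n) (X n \<omega>) $ i $ j)"
    and tail: "0 < z \<Longrightarrow>
      prob {\<omega> \<in> space M. z \<le> norm (Vh n \<omega> - gradV Pc Pmax (H n) (X n \<omega>))} \<le> B / z powr \<beta>"
    and tail_constants: "0 \<le> B" "2 < \<beta>"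
begin

sublocale adapted_projected_ascent M F XSet "\<lambda>n. \<gamma> / real (Suc n) powr \<alpha>" X Vh
  by unfold_locales (fact compact_XSet convex_XSet initial initial_measurable estimate_measurable
      step[unfolded proj_eq_closest_point])+

lemma error_measurable: "(\<lambda>\<omega>. Vh n \<omega> - gradV Pc Pmax (H n) (X n \<omega>)) \<in> borel_measurable M"
  by (intro borel_measurable_diff measurable_of_F[OF estimate_measurable]
      measurable_of_F[OF continuous_iterate_measurable] continuous_on_gradV)

sublocale stochastic_gradient_ascent M F XSet "\<lambda>n. \<gamma> / real (Suc n) powr \<alpha>" X Vh
  "\<lambda>n X. EE Pc (H n) (Qmap Pc Pmax X)" "\<lambda>n. gradV Pc Pmax (H n)" V0
  "1 + 4 * B / (1 - 2 powr (2 - \<beta>))"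
proof
  show "0 < \<gamma> / real (Suc n) powr \<alpha>" for n
    using step_size by simp
  show "antimono (\<lambda>n. \<gamma> / real (Suc n) powr \<alpha>)"
    using step_size by (intro antimono_polynomial_step)
  show "AE \<omega> in M. real_cond_exp M (F n) (\<lambda>\<omega>. inner (Vh n \<omega>) b) \<omega> =
      inner (gradV Pc Pmax (H n) (X n \<omega>)) b"
    if "b \<in> Basis" for n b
    by (rule AE_real_cond_exp_inner_Basis[OF unbiased_Re unbiased_Im that])
  show "square_integrable M (\<lambda>\<omega>. Vh n \<omega> - gradV Pc Pmax (H n) (X n \<omega>))"
    "expectation (\<lambda>\<omega>. (norm (Vh n \<omega> - gradV Pc Pmax (H n) (X n \<omega>)))\<^sup>2) \<le>
      1 + 4 * B / (1 - 2 powr (2 - \<beta>))" for n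
    by (rule square_integrable_of_tail[OF error_measurable tail_constants(2,1) tail]; assumption)+
qed (fact continuous_on_EE_Qmap continuous_on_gradV EE_Qmap_tangent gradient_le)+

end

theorem theorem2:
  fixes Pc Pmax V0 B \<beta> \<gamma> \<alpha> :: real
    and \<Omega> :: "'w measure"
    and F :: "nat \<Rightarrow> 'w measure"
    and H :: "nat \<Rightarrow> complex^('k::finite \<times> 'm::finite)^('k \<times> 'n::finite)"
    and X Vh :: "nat \<Rightarrow> 'w \<Rightarrow> complex^('k \<times> 'm)^('k \<times> 'm)"
    and X1 :: "complex^('k \<times> 'm)^('k \<times> 'm)"
  assumes "prob_space \<Omega>"
    and "Pc > 0" and "Pmax > 0"
    and "\<forall>n\<ge>1. block_diag (H n)"
    and "\<exists>C. \<forall>n\<ge>1. norm (H n) \<le> C"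
    and "\<forall>n\<ge>1. \<forall>\<omega>\<in>space \<Omega>. norm (gradV Pc Pmax (H n) (X n \<omega>)) \<le> V0"
    and "X1 \<in> XSet"
    and "\<forall>\<omega>\<in>space \<Omega>. X 1 \<omega> = X1"
    and "\<forall>n\<ge>1. \<forall>\<omega>\<in>space \<Omega>.
           X (Suc n) \<omega> = proj (X n \<omega> + (\<gamma> / real n powr \<alpha>) *\<^sub>R Vh n \<omega>)"
    and "\<forall>n\<ge>1. Vh n \<in> borel_measurable \<Omega> \<and> (\<forall>\<omega>\<in>space \<Omega>. hermitian (Vh n \<omega>))"
    and "\<forall>n. subalgebra \<Omega> (F n)"
    and "\<forall>n m. n \<le> m \<longrightarrow> sets (F n) \<subseteq> sets (F m)"
    and "\<forall>n k. 1 \<le> k \<and> k < n \<longrightarrow> Vh k \<in> borel_measurable (F n)"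
    and "\<forall>n\<ge>1. integrable \<Omega> (Vh n)"
    and "\<forall>n\<ge>1. \<forall>i j. (AE \<omega> in \<Omega>. real_cond_exp \<Omega> (F n) (\<lambda>\<omega>. Re (Vh n \<omega> $ i $ j)) \<omega>
                                  = Re (gradV Pc Pmax (H n) (X n \<omega>) $ i $ j))
                       \<and> (AE \<omega> in \<Omega>. real_cond_exp \<Omega> (F n) (\<lambda>\<omega>. Im (Vh n \<omega> $ i $ j)) \<omega>
                                  = Im (gradV Pc Pmax (H n) (X n \<omega>) $ i $ j))"
    and "B > 0" and "\<beta> > 2"
    and "\<forall>n\<ge>1. \<forall>z>0. measure \<Omega> {\<omega>\<in>space \<Omega>. z \<le> norm (Vh n \<omega> - gradV Pc Pmax (H n) (X n \<omega>))}
                       \<le> B / z powr \<beta>"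
    and "\<gamma> > 0" and "2 / \<beta> < \<alpha>" and "\<alpha> < 1"
  shows "(AE \<omega> in \<Omega>. limsup (\<lambda>T. ereal (regret Pc Pmax H (\<lambda>n. Qmap Pc Pmax (X n \<omega>)) T / real T)) \<le> 0)
       \<and> (\<forall>T\<ge>1. integrable \<Omega> (\<lambda>\<omega>. regret Pc Pmax H (\<lambda>n. Qmap Pc Pmax (X n \<omega>)) T)
              \<and> (\<integral>\<omega>. regret Pc Pmax H (\<lambda>n. Qmap Pc Pmax (X n \<omega>)) T \<partial>\<Omega>)
                  \<le> 1 / (\<gamma> / real T powr \<alpha>)
                    + (SUP n\<in>{1..}. \<integral>\<omega>. (norm (Vh n \<omega>))\<^sup>2 \<partial>\<Omega>) / 2
                      * (\<Sum>n = 1..T. \<gamma> / real n powr \<alpha>))"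
proof -
  interpret prob_space \<Omega> by fact
  have \<alpha>_pos: "0 < \<alpha>"
    using \<open>\<beta> > 2\<close> \<open>2 / \<beta> < \<alpha>\<close> less_trans[of 0 "2 / \<beta>" \<alpha>] by simp
  have "X 1 \<in> borel_measurable (F 1)"
    using assms(8,11) by (subst measurable_cong[of _ _ "\<lambda>_. X1"]) (auto simp: subalgebra_def)
  then interpret noisy_power_control Pc Pmax \<Omega> "\<lambda>n. F (Suc n)" "\<lambda>n. H (Suc n)"
    "\<lambda>n. X (Suc n)" "\<lambda>n. Vh (Suc n)" \<gamma> \<alpha> B \<beta> V0
    using assms(2,3,6-9,11-13,15-19) \<alpha>_pos
    by unfold_locales (simp_all add: subalgebra_def del: split_paired_All)
  show ?thesis
    unfolding regret_eq_static_regret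
  proof (intro conjI allI impI AE_no_regret static_regret_integrable)
    show "summable (\<lambda>n. \<gamma> / real (Suc n) powr \<alpha> / real (Suc n))"
      by (rule summable_polynomial_step[OF \<alpha>_pos])
    show "(\<lambda>n. 1 / (\<gamma> / real (Suc n) powr \<alpha> * real (Suc n))) \<longlonglongrightarrow> 0"
      by (rule inverse_polynomial_step_average_tendsto_0) fact+
    fix T :: nat
    assume "T \<ge> 1"
    then obtain t where "T = Suc t"
      by (cases T) auto
    moreover have "{1..} = range Suc"
      by (simp add: atLeast_Suc_greaterThan greaterThan_0)
    ultimately show "expectation (\<lambda>\<omega>. static_regret XSet (\<lambda>n Y. EE Pc (H (Suc n)) (Qmap Pc Pmax Y))
        (\<lambda>n. X (Suc n) \<omega>) T) \<le> 1 / (\<gamma> / real T powr \<alpha>)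
        + (SUP n\<in>{1..}. expectation (\<lambda>\<omega>. (norm (Vh n \<omega>))\<^sup>2)) / 2 * (\<Sum>n = 1..T. \<gamma> / real n powr \<alpha>)"
      using expected_regret_le_SUP[OF diameter_XSet_power2_le, of t]
      by (simp add: image_image sum.atLeast1_atMost_eq lessThan_Suc_atMost
          del: of_nat_Suc sum.cl_ivl_Suc sum.lessThan_Suc)
  qed
qed

end
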